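(* The ring $\mathcal E$ of $E$-functions is neither factorial nor noetherian. Moreover, if Conjecture F (stated in the context) holds, then $\mathcal E$ is a gcd domain, i.e. any two non-zero elements of $\mathcal E$ have a greatest common divisor (a common divisor divisible by every common divisor).
   Context: $\overline{\mathbb Q}$ is embedded in $\mathbb C$. A power series $f(x)=\sum_{n\ge0}a_n x^n/n!\in\overline{\mathbb Q}[[x]]$ is an $E$-function if: (i) $f$ satisfies a non-zero linear differential equation with coefficients in $\overline{\mathbb Q}(x)$; (ii) there is $C_1>0$ such that all Galois conjugates of $a_n$ have modulus $\le C_1^{n+1}$ for all $n\ge0$; (iii) there are $C_2>0$ and positive integers $d_n\le C_2^{n+1}$ such that $d_na_m$ is an algebraic integer for all $m\le n$. $E$-functions form an integral domain $\mathcal E$ whose units are the functions $\lambda e^{\alpha x}$, $\lambda,\alpha\in\overline{\mathbb Q}$, $\lambda\ne0$. An irreducible $E$-function is a non-unit $f$ such that $f=gh$ with $g,h\in\mathcal E$ implies $g$ or $h$ is a unit. A simple $E$-function is one of the form $g(x)=x^{-\omega}e^{\alpha x}\sum_{i=1}^N\lambda_ie^{\beta r_ix}$ with $\alpha,\beta\in\overline{\mathbb Q}$, $\beta\ne0$, $N\ge2$, $\lambda_i\in\overline{\mathbb Q}^*$, pairwise distinct $r_i\in\mathbb Q$, and the integer $\omega$ chosen so that $g$ is holomorphic at $0$ with $g(0)\ne0$; its support is $\mathrm{Span}_{\mathbb Q}(\beta)$. A non-zero $f\in\mathcal E$ with Taylor expansion $\sum_n a_nx^n$ at $0$ is normalized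 if for some $p\ge0$, $a_0=\dots=a_{p-1}=0$, $a_p=1$, $a_{p+1}=0$. Conjecture F: every non-zero $E$-function $f$ can be written as $f=us_1\cdots s_ph_1\cdots h_n$ ($p,n\ge0$) with $u$ a unit, $s_1,\dots,s_p$ simple normalized $E$-functions with pairwise distinct supports, and $h_1,\dots,h_n$ irreducible normalized $E$-functions, and $u,s_1,\dots,s_p,h_1,\dots,h_n$ are unique (the $s_i$, $h_j$ up to order). *)

theory Defs
  imports
    "HOL-Algebra.Ring_Divisibility"
    "HOL-Computational_Algebra.Computational_Algebra"
    Complex_Main
begin

section \<open>Algebraic numbers and Galois conjugates\<close>

abbreviation Qbar :: "complex set" where
  "Qbar \<equiv> {z. algebraic z}"

text \<open>
  Elements of the absolute Galois group of the rationals, acting on \<^term>\<open>Qbar\<close>; the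
  values of \<open>\<sigma>\<close> outside \<^term>\<open>Qbar\<close> are irrelevant.
\<close>
definition galois_aut :: "(complex \<Rightarrow> complex) \<Rightarrow> bool" where
  "galois_aut \<sigma> \<longleftrightarrow>
     bij_betw \<sigma> Qbar Qbar \<and>
     (\<forall>q::rat. \<sigma> (of_rat q) = of_rat q) \<and>
     (\<forall>x\<in>Qbar. \<forall>y\<in>Qbar. \<sigma> (x + y) = \<sigma> x + \<sigma> y \<and> \<sigma> (x * y) = \<sigma> x * \<sigma> y)"

definition galois_conjugates :: "complex \<Rightarrow> complex set" where
  "galois_conjugates a = {\<sigma> a | \<sigma>. galois_aut \<sigma>}"

section \<open>The ring of E-functions\<close>

text \<open>
  The field of rational functions over \<^term>\<open>Qbar\<close>, embedded in the field of Laurent series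
  by expansion at \<open>0\<close>.
\<close>
definition Qbar_ratfun :: "complex fls set" where
  "Qbar_ratfun =
     {fps_to_fls (fps_of_poly P) / fps_to_fls (fps_of_poly Q) | P Q.
        (\<forall>i. poly.coeff P i \<in> Qbar) \<and> (\<forall>i. poly.coeff Q i \<in> Qbar) \<and> Q \<noteq> 0}"

definition satisfies_linear_ODE :: "complex fps \<Rightarrow> bool" where
  "satisfies_linear_ODE f \<longleftrightarrow>
     (\<exists>(r::nat) (c :: nat \<Rightarrow> complex fls).
        (\<forall>k\<le>r. c k \<in> Qbar_ratfun) \<and> (\<exists>k\<le>r. c k \<noteq> 0) \<and>
        (\<Sum>k\<le>r. c k * fps_to_fls ((fps_deriv ^^ k) f)) = 0)"

text \<open>The coefficient \<open>a\<^sub>n\<close> in the expansion \<open>f(x) = \<Sum> a\<^sub>n x\<^sup>n / n!\<close>.\<close>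
definition egf_coeff :: "complex fps \<Rightarrow> nat \<Rightarrow> complex" where
  "egf_coeff f n = fact n * fps_nth f n"

definition E_function :: "complex fps \<Rightarrow> bool" where
  "E_function f \<longleftrightarrow>
     (\<forall>n. egf_coeff f n \<in> Qbar) \<and>
     satisfies_linear_ODE f \<and>
     (\<exists>C1>0::real. \<forall>n. \<forall>b\<in>galois_conjugates (egf_coeff f n). norm b \<le> C1 ^ (n + 1)) \<and>
     (\<exists>C2>0::real. \<exists>d :: nat \<Rightarrow> nat. \<forall>n.
        0 < d n \<and> real (d n) \<le> C2 ^ (n + 1) \<and>
        (\<forall>m\<le>n. algebraic_int (of_nat (d n) * egf_coeff f m)))"

definition E_ring :: "complex fps ring" where
  "E_ring = \<lparr>carrier = {f. E_function f}, mult = (*), one = 1, zero = 0, add = (+)\<rparr>"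

definition irreducible_E :: "complex fps \<Rightarrow> bool" where
  "irreducible_E f \<longleftrightarrow>
     f \<in> carrier E_ring \<and> f \<notin> Units E_ring \<and>
     (\<forall>g\<in>carrier E_ring. \<forall>h\<in>carrier E_ring.
        f = g * h \<longrightarrow> g \<in> Units E_ring \<or> h \<in> Units E_ring)"

section \<open>Simple and normalized E-functions\<close>

text \<open>
  \<^term>\<open>fls_X_intpow (- \<omega>)\<close> is \<open>x\<close> to the power \<open>-\<omega>\<close>. As \<open>g\<close> is a power series, the equation
  of Laurent series below already says that the right-hand side is holomorphic at \<open>0\<close>.
\<close>
definition simple_E_with :: "complex \<Rightarrow> complex fps \<Rightarrow> bool" where
  "simple_E_with \<beta> g \<longleftrightarrow>
     E_function g \<and> \<beta> \<in> Qbar \<and> \<beta> \<noteq> 0 \<and>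
     (\<exists>(\<omega>::int) (\<alpha>::complex) (N::nat) (l :: nat \<Rightarrow> complex) (r :: nat \<Rightarrow> rat).
        \<alpha> \<in> Qbar \<and> 2 \<le> N \<and>
        (\<forall>i\<in>{1..N}. l i \<in> Qbar \<and> l i \<noteq> 0) \<and> inj_on r {1..N} \<and>
        fps_to_fls g =
          fls_X_intpow (- \<omega>) *
          fps_to_fls (fps_exp \<alpha> * (\<Sum>i=1..N. fps_const (l i) * fps_exp (\<beta> * of_rat (r i)))) \<and>
        fps_nth g 0 \<noteq> 0)"

definition simple_E :: "complex fps \<Rightarrow> bool" where
  "simple_E g \<longleftrightarrow> (\<exists>\<beta>. simple_E_with \<beta> g)"

definition rat_line :: "complex \<Rightarrow> complex set" where
  "rat_line \<beta> = {of_rat q * \<beta> | q. True}"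

text \<open>
  The number \<open>\<beta>\<close> in the representation of a simple E-function is only determined up to a
  non-zero rational factor, but the line it spans is unique, by linear independence of
  exponentials with distinct exponents.
\<close>
definition E_support :: "complex fps \<Rightarrow> complex set" where
  "E_support g = (THE S. \<exists>\<beta>. simple_E_with \<beta> g \<and> S = rat_line \<beta>)"

definition normalized_E :: "complex fps \<Rightarrow> bool" where
  "normalized_E f \<longleftrightarrow>
     E_function f \<and> f \<noteq> 0 \<and>
     (\<exists>p. (\<forall>i<p. fps_nth f i = 0) \<and> fps_nth f p = 1 \<and> fps_nth f (p + 1) = 0)"

section \<open>The factorization conjecture and gcd domains\<close>

definition E_factorization ::
  "complex fps \<Rightarrow> complex fps \<Rightarrow> complex fps list \<Rightarrow> complex fps list \<Rightarrow> bool" where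
  "E_factorization f u ss hs \<longleftrightarrow>
     f = u * prod_list ss * prod_list hs \<and>
     u \<in> Units E_ring \<and>
     (\<forall>s\<in>set ss. simple_E s \<and> normalized_E s) \<and> distinct (map E_support ss) \<and>
     (\<forall>h\<in>set hs. irreducible_E h \<and> normalized_E h)"

text \<open>Uniqueness up to order is equality of the underlying multisets.\<close>
definition Conjecture_F :: bool where
  "Conjecture_F \<longleftrightarrow>
     (\<forall>f\<in>carrier E_ring. f \<noteq> 0 \<longrightarrow>
        (\<exists>u ss hs. E_factorization f u ss hs \<and>
           (\<forall>u' ss' hs'. E_factorization f u' ss' hs' \<longrightarrow>
              u' = u \<and> mset ss' = mset ss \<and> mset hs' = mset hs)))"

definition gcd_domain :: "('a, 'b) ring_scheme \<Rightarrow> bool" where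
  "gcd_domain R \<longleftrightarrow>
     domain R \<and>
     (\<forall>a\<in>carrier R - {\<zero>\<^bsub>R\<^esub>}. \<forall>b\<in>carrier R - {\<zero>\<^bsub>R\<^esub>}.
        \<exists>d\<in>carrier R. d gcdof\<^bsub>R\<^esub> a b)"

end

theory Submission
  imports
    Defs
    "Jordan_Normal_Form.Char_Poly"
    "HOL-Analysis.FPS_Convergence"
begin

text \<open>
  With \<open>f\<^sub>n = exp (x / 2^n) - 1\<close> one has \<open>f\<^sub>n = f\<^sub>n\<^sub>+\<^sub>1 (f\<^sub>n\<^sub>+\<^sub>1 + 2)\<close>, and \<open>f\<^sub>n\<^sub>+\<^sub>1 + 2\<close> is not a unit because
  E-functions are entire and it has a zero. So \<open>f\<^sub>0, f\<^sub>1, \<dots>\<close> is an infinite chain of proper divisors,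
  which excludes both unique factorization and the noetherian property.

  Under the conjecture, a non-zero E-function is the same thing as a unit, a family of simple
  normalized functions indexed by the lines \<open>\<rat>\<beta>\<close> (almost all equal to \<open>1\<close>), and a multiset of irreducible
  functions. Products of simple functions with the same support are simple, so this correspondence
  is multiplicative and gcds can be formed componentwise. For two simple functions with the same
  support one writes both as \<open>x^(-\<omega>) exp (\<alpha> x) P(exp (\<delta> x))\<close> with a common \<open>\<delta>\<close> and takes the gcd of the
  two polynomials: a Bezout relation over the algebraic numbers shows that every common divisor among
  E-functions divides it, up to a power of \<open>x\<close>. That power can be divided out, because
  \<open>g\<close> is an E-function whenever \<open>x g\<close> is one.
\<close>

section \<open>Finitely generated modules over a subring\<close>

text \<open>A divisor of a simple function is a priori an arbitrary E-function, so a gcd among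
  exponential polynomials is not enough: only a Bezout relation controls such a divisor c. The stray
  power of x is harmless because c(0) is non-zero, c being a factor of a function with non-zero
  value at 0. Dividing by x introduces denominators n + 1; condition (iii) survives because lcm(1,
  ..., n) grows at most geometrically, which is derived here from central binomial coefficients.
  Uniqueness in the conjecture serves one purpose: if f = c e, then the factorizations of c and e,
  merged support by support, must be the factorization of f. Merging preserves normalization because
  a normalized simple function has the expansion 1 + 0 x + ..., a shape stable under products. That
  E-functions form a ring at all rests on one device used twice, namely finitely generated modules
  stable under an operator: over the integers for algebraic integers, and over the polynomials for
  differential equations.\<close>

locale subring_of =
  fixes R :: "'a::comm_ring_1 set"
  assumes zero_mem: "0 \<in> R" and one_mem: "1 \<in> R"
    and add_mem: "x \<in> R \<Longrightarrow> y \<in> R \<Longrightarrow> x + y \<in> R"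
    and mult_mem: "x \<in> R \<Longrightarrow> y \<in> R \<Longrightarrow> x * y \<in> R"
    and uminus_mem: "x \<in> R \<Longrightarrow> - x \<in> R"
begin

lemma sum_mem: "(\<And>i. i \<in> I \<Longrightarrow> f i \<in> R) \<Longrightarrow> (\<Sum>i\<in>I. f i) \<in> R"
  by (induction I rule: infinite_finite_induct) (auto simp: zero_mem add_mem)

lemma power_mem: "x \<in> R \<Longrightarrow> x ^ n \<in> R"
  by (induction n) (auto simp: one_mem mult_mem)

lemma of_nat_mem: "of_nat n \<in> R"
  by (induction n) (auto simp: zero_mem one_mem add_mem)

lemma diff_mem: "x \<in> R \<Longrightarrow> y \<in> R \<Longrightarrow> x - y \<in> R"
  using add_mem[of x "- y"] uminus_mem[of y] by simp

text \<open>Coefficients are indexed by the generators themselves. For infinite W the sum is 0 by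
  convention, so finiteness of W is assumed wherever the generators have to lie in their
  span.\<close>

definition rspan :: "'a set \<Rightarrow> 'a set" where
  "rspan W = {\<Sum>w\<in>W. a w * w | a. \<forall>w\<in>W. a w \<in> R}"

lemma rspan_0: "0 \<in> rspan W"
  unfolding rspan_def by (rule CollectI, rule exI[of _ "\<lambda>_. 0"]) (simp add: zero_mem)

lemma rspan_add: "x \<in> rspan W \<Longrightarrow> y \<in> rspan W \<Longrightarrow> x + y \<in> rspan W"
proof -
  assume "x \<in> rspan W" "y \<in> rspan W"
  then obtain a b where "x = (\<Sum>w\<in>W. a w * w)" "\<forall>w\<in>W. a w \<in> R"
     "y = (\<Sum>w\<in>W. b w * w)" "\<forall>w\<in>W. b w \<in> R" unfolding rspan_def by auto
  then show ?thesis unfolding rspan_def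
    by (intro CollectI exI[of _ "\<lambda>w. a w + b w"]) (auto simp: add_mem sum.distrib algebra_simps)
qed

lemma rspan_scale: "r \<in> R \<Longrightarrow> x \<in> rspan W \<Longrightarrow> r * x \<in> rspan W"
proof -
  assume r: "r \<in> R" and "x \<in> rspan W"
  then obtain a where "x = (\<Sum>w\<in>W. a w * w)" "\<forall>w\<in>W. a w \<in> R" unfolding rspan_def by auto
  then show ?thesis unfolding rspan_def using r
    by (intro CollectI exI[of _ "\<lambda>w. r * a w"]) (auto simp: mult_mem sum_distrib_left mult.assoc)
qed

lemma rspan_sum: "(\<And>i. i \<in> I \<Longrightarrow> f i \<in> rspan W) \<Longrightarrow> (\<Sum>i\<in>I. f i) \<in> rspan W"
  by (induction I rule: infinite_finite_induct) (auto simp: rspan_0 rspan_add)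

lemma rspan_base: "finite W \<Longrightarrow> w \<in> W \<Longrightarrow> w \<in> rspan W"
  unfolding rspan_def
  by (intro CollectI exI[of _ "\<lambda>v. if v = w then 1 else 0"])
     (auto simp: zero_mem one_mem if_distrib[of "\<lambda>x. x * _"] sum.delta cong: if_cong)

lemma rspan_diff: "x \<in> rspan W \<Longrightarrow> y \<in> rspan W \<Longrightarrow> x - y \<in> rspan W"
  using rspan_add[of x W "- y"] rspan_scale[of "-1" y W] uminus_mem[OF one_mem] by simp

text \<open>Linearity reduces a claim about multiplication by g to the generators. The case g = 1
  compares two spans; for W' = W it says that g acts on the module.\<close>

lemma rspan_mult_subset:
  assumes "x \<in> rspan W" "\<And>w. w \<in> W \<Longrightarrow> g * w \<in> rspan W'"
  shows "g * x \<in> rspan W'"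
proof -
  obtain a where a: "x = (\<Sum>w\<in>W. a w * w)" "\<forall>w\<in>W. a w \<in> R" using assms(1) unfolding rspan_def by auto
  have "g * x = (\<Sum>w\<in>W. a w * (g * w))" by (simp add: a sum_distrib_left algebra_simps)
  also have "\<dots> \<in> rspan W'"
    by (rule rspan_sum, rule rspan_scale) (use a assms(2) in auto)
  finally show ?thesis .
qed

lemma rspan_subset:
  assumes "x \<in> rspan W" "\<And>w. w \<in> W \<Longrightarrow> w \<in> rspan W'"
  shows "x \<in> rspan W'"
  using rspan_mult_subset[of x W 1 W'] assms by simp

lemma rspan_mult:
  assumes "finite W" "finite W'" "x \<in> rspan W" "y \<in> rspan W'"
  shows "x * y \<in> rspan ((\<lambda>(v, w). v * w) ` (W \<times> W'))"
proof (rule rspan_mult_subset[OF assms(4)])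
  fix w assume w: "w \<in> W'"
  have "w * x \<in> rspan ((\<lambda>(v, w). v * w) ` (W \<times> W'))"
    by (rule rspan_mult_subset[OF assms(3)])
       (use assms w in \<open>auto intro!: rspan_base simp: mult.commute image_iff\<close>)
  then show "x * w \<in> rspan ((\<lambda>(v, w). v * w) ` (W \<times> W'))" by (simp add: mult.commute)
qed

end

text \<open>Fraction-free Gaussian elimination, by induction on the equations, which are indexed by
  W; the unknowns are indexed by I. Cross-multiplication replaces division, as R need not be a
  field.\<close>

lemma (in subring_of) homogeneous_system_solution:
  fixes A :: "'i \<Rightarrow> 'j \<Rightarrow> 'a"
  assumes "finite W" "finite I" "card W < card I"
    and "\<And>i w. i \<in> I \<Longrightarrow> w \<in> W \<Longrightarrow> A i w \<in> R"
    and idom: "\<And>x y :: 'a. x * y = 0 \<Longrightarrow> x = 0 \<or> y = 0"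
  shows "\<exists>c. (\<forall>i\<in>I. c i \<in> R) \<and> (\<exists>i\<in>I. c i \<noteq> 0) \<and> (\<forall>w\<in>W. (\<Sum>i\<in>I. c i * A i w) = 0)"
  using assms(1-4)
proof (induction W arbitrary: I A rule: finite_induct)
  case empty
  then obtain i where "i \<in> I" by (metis card_gt_0_iff all_not_in_conv card.empty)
  then show ?case by (intro exI[of _ "\<lambda>_. 1"]) (auto simp: one_mem)
next
  case (insert v W)
  show ?case
  proof (cases "\<forall>i\<in>I. A i v = 0")
    case True
    have "card W < card I" using insert by simp
    from insert.IH[OF insert.prems(1) this] insert.prems(3) obtain c where
      "\<forall>i\<in>I. c i \<in> R" "\<exists>i\<in>I. c i \<noteq> 0" "\<forall>w\<in>W. (\<Sum>i\<in>I. c i * A i w) = 0" by blast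
    then show ?thesis using True by (intro exI[of _ c]) auto
  next
    case False
    then obtain k where k: "k \<in> I" "A k v \<noteq> 0" by auto
    define J where "J = I - {k}"
    have I: "I = insert k J" "k \<notin> J" "finite J" using k insert.prems by (auto simp: J_def)
    \<comment> \<open>Cross-multiplying with the pivot \<open>A k v\<close> eliminates column v and
      keeps all entries in R.\<close>
    define B where "B = (\<lambda>i w. A k v * A i w - A i v * A k w)"
    have "card W < card J" using insert I by simp
    moreover have "\<And>i w. i \<in> J \<Longrightarrow> w \<in> W \<Longrightarrow> B i w \<in> R"
      unfolding B_def using insert.prems(3) k I by (intro diff_mem mult_mem) auto
    ultimately obtain c where c: "\<forall>i\<in>J. c i \<in> R" "\<exists>i\<in>J. c i \<noteq> 0"
      "\<forall>w\<in>W. (\<Sum>i\<in>J. c i * B i w) = 0" using insert.IH[of J B] I(3) by blast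
    \<comment> \<open>Back substitution: the smaller solution is scaled by the pivot, and the
      coordinate at k takes the value forced by the equation for v.\<close>
    define d where "d = (\<lambda>i. if i = k then - (\<Sum>j\<in>J. c j * A j v) else A k v * c i)"
    have dJ: "(\<Sum>i\<in>J. d i * A i w) = (\<Sum>i\<in>J. A k v * c i * A i w)" for w
      by (rule sum.cong) (use I in \<open>auto simp: d_def\<close>)
    have S: "(\<Sum>i\<in>I. d i * A i w) = (\<Sum>i\<in>J. c i * B i w)" for w
      unfolding I(1) sum.insert[OF I(3,2)] dJ
      by (simp add: d_def B_def sum_distrib_left sum_distrib_right sum_subtractf algebra_simps)
    have "(\<Sum>i\<in>I. d i * A i w) = 0" if "w \<in> insert v W" for w
    proof (cases "w = v")
      case True
      then show ?thesis unfolding S by (simp add: B_def algebra_simps)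
    next
      case False
      then show ?thesis using that c S by auto
    qed
    moreover have "\<exists>i\<in>I. d i \<noteq> 0" using c(2) k I idom unfolding d_def by fastforce
    moreover have "\<forall>i\<in>I. d i \<in> R" unfolding d_def using c(1) insert.prems(3) k I
      by (auto intro!: uminus_mem sum_mem mult_mem)
    ultimately show ?thesis by blast
  qed
qed

text \<open>Expand each \<open>v i\<close> in the generators and ask for the coefficient of every
  generator to vanish: this is a homogeneous system with fewer equations than unknowns.\<close>

lemma (in subring_of) rspan_dependent:
  assumes "finite W" "finite I" "card W < card I"
    and "\<And>i. i \<in> I \<Longrightarrow> v i \<in> rspan W"
    and idom: "\<And>x y :: 'a. x * y = 0 \<Longrightarrow> x = 0 \<or> y = 0"
  shows "\<exists>c. (\<forall>i\<in>I. c i \<in> R) \<and> (\<exists>i\<in>I. c i \<noteq> 0) \<and> (\<Sum>i\<in>I. c i * v i) = 0"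
proof -
  have "\<forall>i\<in>I. \<exists>a. v i = (\<Sum>w\<in>W. a w * w) \<and> (\<forall>w\<in>W. a w \<in> R)"
    using assms(4) unfolding rspan_def by blast
  then obtain A where A: "\<And>i. i \<in> I \<Longrightarrow> v i = (\<Sum>w\<in>W. A i w * w)" "\<And>i w. i \<in> I \<Longrightarrow> w \<in> W \<Longrightarrow> A i w \<in> R"
    by metis
  obtain c where
    c: "\<forall>i\<in>I. c i \<in> R" "\<exists>i\<in>I. c i \<noteq> 0" "\<forall>w\<in>W. (\<Sum>i\<in>I. c i * A i w) = 0"
    using homogeneous_system_solution[of W I A, OF assms(1-3)] A(2) idom by blast
  have "(\<Sum>i\<in>I. c i * v i) = (\<Sum>i\<in>I. \<Sum>w\<in>W. c i * A i w * w)"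
    by (intro sum.cong) (simp_all add: A sum_distrib_left algebra_simps)
  also have "\<dots> = (\<Sum>w\<in>W. (\<Sum>i\<in>I. c i * A i w) * w)"
    by (subst sum.swap) (simp add: sum_distrib_right)
  also have "\<dots> = 0" using c by simp
  finally show ?thesis using c by blast
qed

section \<open>Algebraic numbers\<close>

interpretation Z: subring_of "\<int> :: complex set"
  by unfold_locales auto

text \<open>Determinant trick: g acts on the generators through an integer matrix A, and the vector
  of generators, non-zero because of w0, is an eigenvector for g. So g is a root of the
  characteristic polynomial of A, which is monic with integer coefficients.\<close>

lemma algebraic_int_if_stabilizes:
  fixes g :: complex
  assumes "finite W" "w0 \<in> W" "w0 \<noteq> 0" "\<And>w. w \<in> W \<Longrightarrow> g * w \<in> Z.rspan W"
  shows "algebraic_int g"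
proof -
  obtain ws where ws: "set ws = W" "distinct ws" using assms(1) finite_distinct_list by blast
  define n where "n = length ws"
  have "\<forall>w\<in>W. \<exists>a. g * w = (\<Sum>v\<in>W. of_int (a v) * v)"
  proof
    fix w assume "w \<in> W"
    then obtain a where a: "g * w = (\<Sum>v\<in>W. a v * v)" "\<forall>v\<in>W. a v \<in> \<int>"
      using assms(4) unfolding Z.rspan_def by blast
    then have "\<forall>v\<in>W. \<exists>b. a v = of_int b" by (auto elim: Ints_cases)
    then obtain b where "\<forall>v\<in>W. a v = of_int (b v)" by metis
    then show "\<exists>a. g * w = (\<Sum>v\<in>W. of_int (a v) * v)" using a by (intro exI[of _ b]) simp
  qed
  then obtain a where a: "\<And>w. w \<in> W \<Longrightarrow> g * w = (\<Sum>v\<in>W. of_int (a w v) * v)" by metis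
  define A :: "int Matrix.mat" where "A = Matrix.mat n n (\<lambda>(i,j). a (ws ! i) (ws ! j))"
  define v :: "complex Matrix.vec" where "v = Matrix.vec n (\<lambda>i. ws ! i)"
  have A: "A \<in> carrier_mat n n" by (simp add: A_def)
  let ?B = "map_mat of_int A :: complex Matrix.mat"
  have B: "?B \<in> carrier_mat n n" using A by simp
  have "eigenvector ?B v g"
    unfolding eigenvector_def
  proof (intro conjI)
    show "v \<in> carrier_vec (dim_row ?B)" using A by (simp add: v_def)
    obtain k where "k < n" "ws ! k = w0" using ws assms(2) by (metis in_set_conv_nth n_def)
    then have "v $ k \<noteq> 0\<^sub>v n $ k" using assms(3) by (simp add: v_def)
    then show "v \<noteq> 0\<^sub>v (dim_row ?B)" using A by auto
    show "?B *\<^sub>v v = g \<cdot>\<^sub>v v"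
    proof (rule eq_vecI)
      fix i assume "i < dim_vec (g \<cdot>\<^sub>v v)"
      then have i: "i < n" by (simp add: v_def)
      have "(?B *\<^sub>v v) $ i = (\<Sum>j<n. of_int (a (ws ! i) (ws ! j)) * ws ! j)"
        using i by (simp add: A_def v_def mult_mat_vec_def scalar_prod_def lessThan_atLeast0)
      also have "\<dots> = (\<Sum>v\<in>W. of_int (a (ws ! i) v) * v)"
        unfolding n_def by (rule sum.reindex_bij_betw[OF bij_betw_nth[OF ws(2)]]) (use ws in auto)
      also have "\<dots> = g * ws ! i" using a[of "ws ! i"] i ws n_def nth_mem[of i ws] by auto
      finally show "(?B *\<^sub>v v) $ i = (g \<cdot>\<^sub>v v) $ i" using i by (simp add: v_def)
    qed (use A in \<open>simp add: v_def\<close>)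
  qed
  then have "eigenvalue ?B g" unfolding eigenvalue_def by blast
  then have "poly (char_poly ?B) g = 0" using eigenvalue_root_char_poly[OF B] by simp
  moreover have "char_poly ?B = map_poly of_int (char_poly A)"
    by (rule of_int_hom.char_poly_hom[OF A])
  moreover have "lead_coeff (char_poly A) = 1" using degree_monic_char_poly[OF A] by simp
  ultimately show ?thesis unfolding algebraic_int_altdef_ipoly by metis
qed

text \<open>A monic integral equation of degree n expresses x^n through 1, x, ..., x^(n-1).\<close>

lemma algebraic_int_powers_stable:
  fixes x :: complex
  assumes "algebraic_int x"
  obtains n where "0 < n" "\<And>i. i < n \<Longrightarrow> x * x ^ i \<in> Z.rspan ((\<lambda>i. x ^ i) ` {..<n})"
proof -
  obtain p where p: "lead_coeff p = 1" "\<forall>i. poly.coeff p i \<in> \<int>" "poly p x = 0"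
    using assms by (auto elim: algebraic_int.cases)
  define n where "n = degree p"
  have n0: "0 < n"
  proof (rule ccontr)
    assume "\<not> 0 < n"
    then have "p = 1" using p(1) unfolding n_def by (metis monic_degree_0 neq0_conv)
    then show False using p(3) by simp
  qed
  let ?W = "(\<lambda>i. x ^ i) ` {..<n}"
  have "x ^ n \<in> Z.rspan ?W"
  proof -
    have "0 = (\<Sum>i\<le>n. poly.coeff p i * x ^ i)" using p(3) unfolding poly_altdef n_def by simp
    also have "\<dots> = (\<Sum>i<n. poly.coeff p i * x ^ i) + x ^ n"
      using p(1) by (simp add: n_def lessThan_Suc_atMost[symmetric])
    finally have "x ^ n = 0 - (\<Sum>i<n. poly.coeff p i * x ^ i)" by (simp add: eq_neg_iff_add_eq_0 add.commute)
    also have "\<dots> \<in> Z.rspan ?W"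
      using p(2) by (intro Z.rspan_diff Z.rspan_0 Z.rspan_sum Z.rspan_scale Z.rspan_base) auto
    finally show ?thesis .
  qed
  moreover have "x ^ Suc i \<in> Z.rspan ?W" if "Suc i < n" for i
    using that by (intro Z.rspan_base imageI) auto
  ultimately have "x * x ^ i \<in> Z.rspan ?W" if "i < n" for i
    using that by (cases "Suc i = n") auto
  then show ?thesis using that n0 by blast
qed

text \<open>The finitely many products x^i y^j span a module stable under x and under y, hence under
  x + y and x y; it contains 1, the non-zero vector needed for the eigenvector argument.\<close>

lemma
  fixes x y :: complex
  assumes "algebraic_int x" "algebraic_int y"
  shows algebraic_int_plus: "algebraic_int (x + y)" and algebraic_int_times: "algebraic_int (x * y)"
proof -
  obtain m where m: "0 < m" "\<And>i. i < m \<Longrightarrow> x * x ^ i \<in> Z.rspan ((\<lambda>i. x ^ i) ` {..<m})"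
    using algebraic_int_powers_stable[OF assms(1)] by blast
  obtain n where n: "0 < n" "\<And>i. i < n \<Longrightarrow> y * y ^ i \<in> Z.rspan ((\<lambda>i. y ^ i) ` {..<n})"
    using algebraic_int_powers_stable[OF assms(2)] by blast
  define U where "U = (\<lambda>i. x ^ i) ` {..<m}"
  define V where "V = (\<lambda>i. y ^ i) ` {..<n}"
  define W where "W = (\<lambda>(v, w). v * w) ` (U \<times> V)"
  have fin: "finite U" "finite V" "finite W" by (auto simp: U_def V_def W_def)
  have "1 \<in> U" "1 \<in> V" using m(1) n(1) by (auto simp: U_def V_def image_iff intro!: bexI[of _ 0])
  then have W1: "1 \<in> W" unfolding W_def by force
  have sx: "x * w \<in> Z.rspan W" if wW: "w \<in> W" for w
  proof -
    obtain u v where uv: "w = u * v" "u \<in> U" "v \<in> V" using wW by (auto simp: W_def)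
    have "(x * u) * v \<in> Z.rspan W" unfolding W_def
      by (rule Z.rspan_mult) (use fin uv m(2) in \<open>auto intro: Z.rspan_base simp: U_def\<close>)
    then show ?thesis using uv by (simp add: mult.assoc)
  qed
  have sy: "y * w \<in> Z.rspan W" if wW: "w \<in> W" for w
  proof -
    obtain u v where uv: "w = u * v" "u \<in> U" "v \<in> V" using wW by (auto simp: W_def)
    have "u * (y * v) \<in> Z.rspan W" unfolding W_def
      by (rule Z.rspan_mult) (use fin uv n(2) in \<open>auto intro: Z.rspan_base simp: V_def\<close>)
    then show ?thesis using uv by (simp add: mult.left_commute)
  qed
  show "algebraic_int (x + y)"
    by (rule algebraic_int_if_stabilizes[OF fin(3) W1]) (auto simp: distrib_right intro: Z.rspan_add sx sy)
  show "algebraic_int (x * y)"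
    by (rule algebraic_int_if_stabilizes[OF fin(3) W1])
       (auto simp: mult.assoc intro: Z.rspan_mult_subset[OF sy] sx)
qed

lemma algebraic_int_sum:
  "(\<And>i. i \<in> I \<Longrightarrow> algebraic_int (f i :: complex)) \<Longrightarrow> algebraic_int (\<Sum>i\<in>I. f i)"
  by (induction I rule: infinite_finite_induct) (auto intro: algebraic_int_plus)

lemma algebraic_int_power: "algebraic_int (x :: complex) \<Longrightarrow> algebraic_int (x ^ n)"
  by (induction n) (auto intro: algebraic_int_times)

lemma algebraic_int_of_nat_mult: "algebraic_int (x :: complex) \<Longrightarrow> algebraic_int (of_nat n * x)"
  by (auto intro!: algebraic_int_times)

lemma algebraic_imp_multiple_int:
  fixes x :: complex
  assumes "algebraic x"
  obtains n :: nat where "0 < n" "algebraic_int (of_nat n * x)"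
proof -
  obtain p where p: "\<And>i. poly.coeff p i \<in> \<int>" "p \<noteq> 0" "poly p x = 0" using algebraicE[OF assms] by blast
  define m where "m = degree p"
  define c where "c = lead_coeff p"
  have c: "c \<in> \<int>" "c \<noteq> 0" using p by (auto simp: c_def)
  have m0: "0 < m" using p unfolding m_def by (metis degree_eq_zeroE gr0I mult_zero_right poly_0 poly_pCons add.right_neutral pCons_0_0)
  \<comment> \<open>This is c^(m-1) p(X/c), which is monic with integer coefficients; its root c x
    is therefore an algebraic integer.\<close>
  define q where "q = monom 1 m + (\<Sum>i<m. monom (poly.coeff p i * c ^ (m - 1 - i)) i)"
  have cq: "poly.coeff q i = (if i < m then poly.coeff p i * c ^ (m - 1 - i) else if i = m then 1 else 0)" for i
    by (auto simp: q_def coeff_sum sum.delta)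
  have dq: "degree q = m"
    by (rule antisym) (auto intro!: degree_le le_degree simp: cq)
  have "poly q (c * x) = (c * x) ^ m + (\<Sum>i<m. poly.coeff p i * c ^ (m - 1 - i) * (c * x) ^ i)"
    by (simp add: q_def poly_sum poly_monom)
  also have "(\<Sum>i<m. poly.coeff p i * c ^ (m - 1 - i) * (c * x) ^ i) = c ^ (m - 1) * (\<Sum>i<m. poly.coeff p i * x ^ i)"
    unfolding sum_distrib_left
  proof (rule sum.cong)
    fix i assume "i \<in> {..<m}"
    then have "c ^ (m - 1) = c ^ (m - 1 - i) * c ^ i" by (simp flip: power_add)
    then show "poly.coeff p i * c ^ (m - 1 - i) * (c * x) ^ i = c ^ (m - 1) * (poly.coeff p i * x ^ i)"
      by (simp add: power_mult_distrib)
  qed simp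
  also have "(c * x) ^ m = c ^ (m - 1) * (c * x ^ m)"
    using m0 by (cases m) (auto simp: power_mult_distrib)
  also have "c ^ (m - 1) * (c * x ^ m) + c ^ (m - 1) * (\<Sum>i<m. poly.coeff p i * x ^ i) = c ^ (m - 1) * poly p x"
    unfolding poly_altdef by (simp add: c_def m_def lessThan_Suc_atMost[symmetric] algebra_simps)
  finally have "poly q (c * x) = 0" using p by simp
  then have ai: "algebraic_int (c * x)"
    using p c by (intro algebraic_int.intros[of q]) (auto simp: dq cq)
  obtain k where k: "c = of_int k" using c by (auto elim: Ints_cases)
  show ?thesis
  proof (rule that[of "nat \<bar>k\<bar>"])
    show "0 < nat \<bar>k\<bar>" using k c by auto
    have "of_nat (nat \<bar>k\<bar>) = (of_int \<bar>k\<bar> :: complex)" by simp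
    also have "\<dots> = c \<or> \<dots> = - c" using k by (auto simp: abs_if)
    finally show "algebraic_int (of_nat (nat \<bar>k\<bar>) * x)" using ai by auto
  qed
qed

lemma algebraic_if_multiple_int:
  fixes x :: complex
  assumes "0 < n" "algebraic_int (of_nat n * x)"
  shows "algebraic x"
proof -
  obtain p where p: "\<And>i. poly.coeff p i \<in> \<int>" "p \<noteq> 0" "poly p (of_nat n * x) = 0"
    using algebraicE[OF algebraic_int_imp_algebraic[OF assms(2)]] by blast
  define q where "q = pcompose p [:0, of_nat n:]"
  have "poly q x = 0" using p by (simp add: q_def poly_pcompose mult.commute)
  moreover have "q \<noteq> 0" using p assms(1) by (simp add: q_def pcompose_eq_0_iff)
  moreover have "poly.coeff q i \<in> \<int>" for i
    using p by (simp add: q_def coeff_pcompose_linear)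
  ultimately show ?thesis using algebraicI by blast
qed

lemma
  fixes x y :: complex
  assumes "algebraic x" "algebraic y"
  shows algebraic_plus: "algebraic (x + y)" and algebraic_times: "algebraic (x * y)"
proof -
  obtain m where m: "0 < m" "algebraic_int (of_nat m * x)" using assms algebraic_imp_multiple_int by blast
  obtain n where n: "0 < n" "algebraic_int (of_nat n * y)" using assms algebraic_imp_multiple_int by blast
  have "of_nat (m * n) * (x + y) = of_nat n * (of_nat m * x) + of_nat m * (of_nat n * y)"
    by (simp add: algebra_simps)
  also have "algebraic_int \<dots>" by (rule algebraic_int_plus[OF algebraic_int_of_nat_mult[OF m(2)] algebraic_int_of_nat_mult[OF n(2)]])
  finally show "algebraic (x + y)" using m n algebraic_if_multiple_int[of "m * n"] by simp
  have "of_nat (m * n) * (x * y) = (of_nat m * x) * (of_nat n * y)" by (simp add: algebra_simps)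
  also have "algebraic_int \<dots>" by (rule algebraic_int_times[OF m(2) n(2)])
  finally show "algebraic (x * y)" using m n algebraic_if_multiple_int[of "m * n"] by simp
qed

interpretation Qb: subring_of Qbar
  by unfold_locales (auto intro: algebraic_plus algebraic_times)

section \<open>Galois conjugates\<close>

lemma Qbar_of_rat [simp]: "algebraic (of_rat q :: complex)"
  by (rule rat_imp_algebraic) auto

context
  fixes \<sigma> assumes \<sigma>: "galois_aut \<sigma>"
begin

lemma galois_aut_of_rat: "\<sigma> (of_rat q) = of_rat q"
  using \<sigma> unfolding galois_aut_def by blast

lemma galois_aut_add: "algebraic x \<Longrightarrow> algebraic y \<Longrightarrow> \<sigma> (x + y) = \<sigma> x + \<sigma> y"
  using \<sigma> unfolding galois_aut_def by blast

lemma galois_aut_mult: "algebraic x \<Longrightarrow> algebraic y \<Longrightarrow> \<sigma> (x * y) = \<sigma> x * \<sigma> y"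
  using \<sigma> unfolding galois_aut_def by blast

lemma galois_aut_0: "\<sigma> 0 = 0" and galois_aut_1: "\<sigma> 1 = 1"
  using galois_aut_of_rat[of 0] galois_aut_of_rat[of 1] by simp_all

lemma galois_aut_of_nat: "\<sigma> (of_nat n) = of_nat n"
  using galois_aut_of_rat[of "of_nat n"] by simp

lemma galois_aut_sum:
  "(\<And>i. i \<in> I \<Longrightarrow> algebraic (f i)) \<Longrightarrow> \<sigma> (\<Sum>i\<in>I. f i) = (\<Sum>i\<in>I. \<sigma> (f i))"
proof (induction I rule: infinite_finite_induct)
  case (insert i I)
  have "algebraic (\<Sum>i\<in>I. f i)" using Qb.sum_mem[of I f] insert by simp
  then show ?case using insert by (simp add: galois_aut_add)
qed (auto simp: galois_aut_0)

lemma galois_aut_power: "algebraic x \<Longrightarrow> \<sigma> (x ^ n) = \<sigma> x ^ n"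
proof (induction n)
  case (Suc n)
  then show ?case using Qb.power_mem[of x n] by (simp add: galois_aut_mult)
qed (simp add: galois_aut_1)

lemma galois_aut_divide_of_nat:
  assumes "algebraic x" shows "\<sigma> (x / of_nat n) = \<sigma> x / of_nat n"
proof -
  have "\<sigma> (x * of_rat (1 / of_nat n)) = \<sigma> x * of_rat (1 / of_nat n)"
    using assms by (simp only: galois_aut_mult Qbar_of_rat galois_aut_of_rat)
  then show ?thesis by (simp add: of_rat_divide)
qed

lemma galois_aut_poly:
  assumes "\<And>i. poly.coeff p i \<in> \<int>" "algebraic x"
  shows "\<sigma> (poly p x) = poly p (\<sigma> x)"
proof -
  have c: "\<sigma> (poly.coeff p i) = poly.coeff p i" "algebraic (poly.coeff p i)" for i
  proof -
    obtain k where "poly.coeff p i = of_int k" using assms(1)[of i] by (auto elim: Ints_cases)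
    then show "\<sigma> (poly.coeff p i) = poly.coeff p i" "algebraic (poly.coeff p i)"
      using galois_aut_of_rat[of "of_int k"] by simp_all
  qed
  have "\<sigma> (poly.coeff p i * x ^ i) = poly.coeff p i * \<sigma> x ^ i" for i
    using c[of i] Qb.power_mem[of x i] assms(2) by (simp add: galois_aut_mult galois_aut_power)
  then show ?thesis unfolding poly_altdef
    using c Qb.power_mem[of x] assms(2) by (subst galois_aut_sum) (auto intro: algebraic_times)
qed

end

lemma galois_aut_id: "galois_aut (\<lambda>x. x)"
  unfolding galois_aut_def by (auto simp: bij_betw_def)

text \<open>All conjugates are roots of one integer polynomial that kills x, hence finite in number.
  Inserting 1 keeps the maximum positive, also for x = 0.\<close>

lemma bounded_galois_conjugates:
  assumes "algebraic x"
  obtains C :: real where "0 < C" "\<And>\<sigma>. galois_aut \<sigma> \<Longrightarrow> norm (\<sigma> x) \<le> C"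
proof -
  obtain p where p: "\<And>i. poly.coeff p i \<in> \<int>" "p \<noteq> 0" "poly p x = 0" using algebraicE[OF assms] by blast
  define S where "S = norm ` {z. poly p z = 0}"
  have fin: "finite S" unfolding S_def using poly_roots_finite[OF p(2)] by simp
  show ?thesis
  proof (rule that[of "Max (insert 1 S)"])
    show "0 < Max (insert 1 S)" using fin by (simp add: Max_gr_iff)
    fix \<sigma> assume s: "galois_aut \<sigma>"
    have "poly p (\<sigma> x) = 0" using galois_aut_poly[OF s p(1) assms] p(3) galois_aut_0[OF s] by simp
    then show "norm (\<sigma> x) \<le> Max (insert 1 S)" using fin by (auto simp: S_def intro!: Max_ge)
  qed
qed

section \<open>Linear differential equations over the rational functions\<close>

definition Qbar_poly :: "complex poly set" where
  "Qbar_poly = {p. \<forall>i. algebraic (poly.coeff p i)}"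

interpretation Qp: subring_of Qbar_poly
proof
  fix p q assume "p \<in> Qbar_poly" "q \<in> Qbar_poly"
  then show "p * q \<in> Qbar_poly" unfolding Qbar_poly_def
    by (auto simp: coeff_mult intro!: Qb.sum_mem[unfolded mem_Collect_eq] algebraic_times)
qed (auto simp: Qbar_poly_def algebraic_plus)

lemma Qbar_poly_monom: "algebraic c \<Longrightarrow> monom c n \<in> Qbar_poly"
  by (auto simp: Qbar_poly_def)

text \<open>The polynomials are viewed inside the power series so that scalars and module elements
  live in one ring, as \<open>rspan\<close> requires.\<close>

definition Qbar_pfps :: "complex fps set" where
  "Qbar_pfps = fps_of_poly ` Qbar_poly"

interpretation Qf: subring_of Qbar_pfps
proof
  show "0 \<in> Qbar_pfps" unfolding Qbar_pfps_def using Qp.zero_mem by (auto intro!: image_eqI[of _ _ 0])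
  show "1 \<in> Qbar_pfps" unfolding Qbar_pfps_def using Qp.one_mem by (auto intro!: image_eqI[of _ _ 1])
  fix f g assume "f \<in> Qbar_pfps" "g \<in> Qbar_pfps"
  then obtain p q where pq: "f = fps_of_poly p" "g = fps_of_poly q" "p \<in> Qbar_poly" "q \<in> Qbar_poly"
    unfolding Qbar_pfps_def by auto
  show "f + g \<in> Qbar_pfps" unfolding Qbar_pfps_def
    using pq Qp.add_mem by (auto intro!: image_eqI[of _ _ "p + q"] simp: fps_of_poly_add)
  show "f * g \<in> Qbar_pfps" unfolding Qbar_pfps_def
    using pq Qp.mult_mem by (auto intro!: image_eqI[of _ _ "p * q"] simp: fps_of_poly_mult)
next
  fix f assume "f \<in> Qbar_pfps"
  then obtain p where p: "f = fps_of_poly p" "p \<in> Qbar_poly" unfolding Qbar_pfps_def by auto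
  show "- f \<in> Qbar_pfps" unfolding Qbar_pfps_def
    using p Qp.uminus_mem by (auto intro!: image_eqI[of _ _ "- p"] simp: fps_of_poly_uminus)
qed

lemma Qbar_pfps_deriv: "f \<in> Qbar_pfps \<Longrightarrow> fps_deriv f \<in> Qbar_pfps"
proof -
  assume "f \<in> Qbar_pfps"
  then obtain p where p: "f = fps_of_poly p" "p \<in> Qbar_poly" unfolding Qbar_pfps_def by auto
  have "pderiv p \<in> Qbar_poly" using p(2) Qb.of_nat_mem algebraic_times
    by (auto simp: Qbar_poly_def coeff_pderiv simp del: of_nat_Suc)
  then show ?thesis using p by (auto simp: Qbar_pfps_def simp flip: fps_of_poly_pderiv)
qed

lemma Qbar_pfps_const: "algebraic c \<Longrightarrow> fps_const c \<in> Qbar_pfps"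
  unfolding Qbar_pfps_def
  by (rule image_eqI[of _ _ "[:c:]"]) (auto simp: Qbar_poly_def coeff_pCons split: nat.splits)

lemma Qbar_pfps_X: "fps_X \<in> Qbar_pfps"
  unfolding Qbar_pfps_def
  by (rule image_eqI[of _ _ "[:0, 1:]"]) (auto simp: Qbar_poly_def coeff_pCons split: nat.splits)

definition D_finite :: "complex fps \<Rightarrow> bool" where
  "D_finite f \<longleftrightarrow> (\<exists>(r::nat) c. (\<forall>k\<le>r. c k \<in> Qbar_pfps) \<and> (\<exists>k\<le>r. c k \<noteq> 0) \<and>
     (\<Sum>k\<le>r. c k * (fps_deriv ^^ k) f) = 0)"

lemma fps_to_fls_sum: "fps_to_fls (\<Sum>i\<in>I. f i :: complex fps) = (\<Sum>i\<in>I. fps_to_fls (f i))"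
  by (induction I rule: infinite_finite_induct) (auto simp: fps_to_fls_plus)

text \<open>Clearing denominators replaces rational functions in the Laurent series field by
  polynomials in the power series ring, where the module arguments take place.\<close>

lemma satisfies_linear_ODE_iff: "satisfies_linear_ODE f \<longleftrightarrow> D_finite f"
proof
  assume "D_finite f"
  then obtain r c where c: "\<And>k. k \<le> r \<Longrightarrow> c k \<in> Qbar_pfps" "\<exists>k\<le>r. c k \<noteq> 0"
    "(\<Sum>k\<le>r. c k * (fps_deriv ^^ k) f) = 0" unfolding D_finite_def by blast
  have "fps_to_fls (c k) \<in> Qbar_ratfun" if k: "k \<le> r" for k
  proof -
    obtain p where p: "c k = fps_of_poly p" "p \<in> Qbar_poly" using c(1)[OF k] unfolding Qbar_pfps_def by auto
    then show ?thesis unfolding Qbar_ratfun_def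
      by (intro CollectI exI[of _ p] exI[of _ 1]) (auto simp: Qbar_poly_def)
  qed
  moreover have "(\<Sum>k\<le>r. fps_to_fls (c k) * fps_to_fls ((fps_deriv ^^ k) f)) = 0"
    using arg_cong[OF c(3), of fps_to_fls] by (simp add: fps_to_fls_sum fls_times_fps_to_fls)
  moreover have "\<exists>k\<le>r. fps_to_fls (c k) \<noteq> 0" using c(2) by simp
  ultimately show "satisfies_linear_ODE f" unfolding satisfies_linear_ODE_def
    by (intro exI[of _ r] exI[of _ "\<lambda>k. fps_to_fls (c k)"]) blast
next
  assume "satisfies_linear_ODE f"
  then obtain r c where c: "\<And>k. k \<le> r \<Longrightarrow> c k \<in> Qbar_ratfun" "\<exists>k\<le>r. c k \<noteq> 0"
    "(\<Sum>k\<le>r. c k * fps_to_fls ((fps_deriv ^^ k) f)) = 0" unfolding satisfies_linear_ODE_def by blast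
  have "\<forall>k\<le>r. \<exists>p q. c k = fps_to_fls p / fps_to_fls q \<and> p \<in> Qbar_pfps \<and> q \<in> Qbar_pfps \<and> q \<noteq> 0"
    using c(1) unfolding Qbar_ratfun_def Qbar_pfps_def Qbar_poly_def by fastforce
  then obtain p q where pq: "\<And>k. k \<le> r \<Longrightarrow> c k = fps_to_fls (p k) / fps_to_fls (q k)"
     "\<And>k. k \<le> r \<Longrightarrow> p k \<in> Qbar_pfps" "\<And>k. k \<le> r \<Longrightarrow> q k \<in> Qbar_pfps" "\<And>k. k \<le> r \<Longrightarrow> q k \<noteq> 0"
    by metis
  \<comment> \<open>This is \<open>c k\<close> times the product of all denominators, with the
    factor \<open>q k\<close> already cancelled, so it is visibly a polynomial.\<close>
  define d where "d = (\<lambda>k. p k * (\<Prod>j\<in>{..r} - {k}. q j))"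
  define Q where "Q = (\<Prod>j\<le>r. q j)"
  have prodmem: "(\<Prod>j\<in>J. q j) \<in> Qbar_pfps" if "J \<subseteq> {..r}" for J
    using finite_subset[OF that] that
    by (induction J rule: finite_induct) (auto simp: Qf.one_mem Qf.mult_mem pq)
  have d: "fps_to_fls (d k) = fps_to_fls Q * c k" if "k \<le> r" for k
  proof -
    have "Q = q k * (\<Prod>j\<in>{..r} - {k}. q j)" unfolding Q_def by (rule prod.remove) (use that in auto)
    then show ?thesis using pq(1,4)[OF that] by (simp add: d_def fls_times_fps_to_fls)
  qed
  have Q0: "Q \<noteq> 0" unfolding Q_def using pq by simp
  have "fps_to_fls (\<Sum>k\<le>r. d k * (fps_deriv ^^ k) f) = fps_to_fls Q * (\<Sum>k\<le>r. c k * fps_to_fls ((fps_deriv ^^ k) f))"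
    by (simp add: fps_to_fls_sum fls_times_fps_to_fls d sum_distrib_left mult.assoc)
  then have "(\<Sum>k\<le>r. d k * (fps_deriv ^^ k) f) = 0" unfolding c(3) by simp
  moreover have "\<forall>k\<le>r. d k \<in> Qbar_pfps" unfolding d_def by (auto intro!: Qf.mult_mem pq prodmem)
  moreover have "\<exists>k\<le>r. d k \<noteq> 0" using c(2) d Q0 by (metis fps_to_fls_eq_0_iff mult_eq_0_iff)
  ultimately show "D_finite f" unfolding D_finite_def by blast
qed

lemma D_finite_leading:
  assumes "D_finite f"
  obtains r c where "\<And>k. k \<le> r \<Longrightarrow> c k \<in> Qbar_pfps" "c r \<noteq> 0"
    "(\<Sum>k\<le>r. c k * (fps_deriv ^^ k) f) = 0"
proof -
  obtain m c where c: "\<And>k. k \<le> m \<Longrightarrow> c k \<in> Qbar_pfps" "\<exists>k\<le>m. c k \<noteq> 0"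
    "(\<Sum>k\<le>m. c k * (fps_deriv ^^ k) f) = 0" using assms unfolding D_finite_def by blast
  define r where "r = Max {k. k \<le> m \<and> c k \<noteq> 0}"
  have fin: "finite {k. k \<le> m \<and> c k \<noteq> 0}" by simp
  have r: "r \<le> m" "c r \<noteq> 0" using Max_in[OF fin] c(2) unfolding r_def by auto
  have "c k = 0" if "k \<le> m" "r < k" for k
    using Max_ge[OF fin, of k] that leD unfolding r_def by blast
  then have "(\<Sum>k\<le>r. c k * (fps_deriv ^^ k) f) = (\<Sum>k\<le>m. c k * (fps_deriv ^^ k) f)"
    using r by (intro sum.mono_neutral_left) auto
  then show ?thesis using that[of r c] c r by simp
qed

text \<open>
  A power series is D-finite iff it lies in a finitely generated module over the polynomials that
  is stable under \<open>p \<cdot> d/dx\<close> for some polynomial \<open>p \<noteq> 0\<close>; the denominator \<open>p\<close> is what allows one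
  to work with polynomial instead of rational coefficients.
\<close>
definition D_module :: "complex fps \<Rightarrow> complex fps set \<Rightarrow> bool" where
  "D_module p W \<longleftrightarrow> p \<in> Qbar_pfps \<and> p \<noteq> 0 \<and> finite W \<and> (\<forall>w\<in>W. p * fps_deriv w \<in> Qf.rspan W)"

text \<open>The module is generated by the derivatives of order below r, and the leading coefficient
  \<open>c r\<close> serves as p: times \<open>c r\<close>, the derivative of order r is a
  combination of lower ones.\<close>

lemma D_finite_imp_D_module:
  assumes "D_finite f"
  obtains p W where "D_module p W" "f \<in> Qf.rspan W"
proof -
  obtain r c where c: "\<And>k. k \<le> r \<Longrightarrow> c k \<in> Qbar_pfps" "c r \<noteq> 0"
    "(\<Sum>k\<le>r. c k * (fps_deriv ^^ k) f) = 0" using D_finite_leading[OF assms] by blast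
  define W where "W = (\<lambda>k. (fps_deriv ^^ k) f) ` {..<r}"
  have fin: "finite W" by (simp add: W_def)
  have "0 = (\<Sum>k<r. c k * (fps_deriv ^^ k) f) + c r * (fps_deriv ^^ r) f"
    using c(3) by (simp add: lessThan_Suc_atMost[symmetric])
  then have "c r * (fps_deriv ^^ r) f = 0 - (\<Sum>k<r. c k * (fps_deriv ^^ k) f)"
    by (simp add: eq_neg_iff_add_eq_0 add.commute)
  also have "\<dots> \<in> Qf.rspan W"
    by (rule Qf.rspan_diff[OF Qf.rspan_0], rule Qf.rspan_sum, rule Qf.rspan_scale)
       (use fin c(1) in \<open>auto intro!: Qf.rspan_base simp: W_def\<close>)
  finally have top: "c r * (fps_deriv ^^ r) f \<in> Qf.rspan W" .
  have step: "c r * (fps_deriv ^^ (Suc k)) f \<in> Qf.rspan W" if k: "k < r" for k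
  proof (cases "Suc k = r")
    case False
    with k have "(fps_deriv ^^ (Suc k)) f \<in> W" unfolding W_def by (intro imageI) auto
    then show ?thesis by (intro Qf.rspan_scale c Qf.rspan_base fin) auto
  qed (use top in simp)
  have "D_module (c r) W" unfolding D_module_def using c(1,2) fin step by (auto simp: W_def)
  moreover have "f \<in> Qf.rspan W"
  \<comment> \<open>An equation of order 0 has no lower derivatives, so W is empty; it forces f = 0,
    which lies in the empty span.\<close>
  proof (cases "r = 0")
    case True
    then have "f = 0" using c by simp
    then show ?thesis by (simp add: Qf.rspan_0)
  next
    case False
    then have "f \<in> W" unfolding W_def by (intro image_eqI[of _ _ 0]) auto
    then show ?thesis using fin Qf.rspan_base by blast
  qed
  ultimately show ?thesis using that by blast
qed

lemma D_module_deriv: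
  assumes "D_module p W" "f \<in> Qf.rspan W"
  shows "p * fps_deriv f \<in> Qf.rspan W"
proof -
  obtain a where a: "f = (\<Sum>w\<in>W. a w * w)" "\<forall>w\<in>W. a w \<in> Qbar_pfps"
    using assms(2) unfolding Qf.rspan_def by blast
  have p: "p \<in> Qbar_pfps" "finite W" "\<And>w. w \<in> W \<Longrightarrow> p * fps_deriv w \<in> Qf.rspan W"
    using assms(1) unfolding D_module_def by auto
  have "p * fps_deriv f = (\<Sum>w\<in>W. a w * (p * fps_deriv w) + (p * fps_deriv (a w)) * w)"
    by (simp add: a(1) fps_deriv_sum sum_distrib_left algebra_simps)
  also have "\<dots> \<in> Qf.rspan W"
    by (rule Qf.rspan_sum, rule Qf.rspan_add; rule Qf.rspan_scale)
       (use a(2) p in \<open>auto intro: Qf.mult_mem Qbar_pfps_deriv Qf.rspan_base\<close>)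
  finally show ?thesis .
qed

text \<open>Each derivative costs one factor p. Leibniz applied to p^n g gives p^(n+1) g' as p (p^n
  g)' minus n p' (p^n g), and both terms are in the span.\<close>

lemma D_module_higher_deriv:
  assumes "D_module p W" "f \<in> Qf.rspan W"
  shows "p ^ n * (fps_deriv ^^ n) f \<in> Qf.rspan W"
proof (induction n)
  case (Suc n)
  let ?g = "(fps_deriv ^^ n) f"
  have p: "p \<in> Qbar_pfps" using assms(1) unfolding D_module_def by auto
  have "p * fps_deriv (p ^ n * ?g) = of_nat n * fps_deriv p * (p ^ n * ?g) + p ^ Suc n * fps_deriv ?g"
  proof -
    have "fps_deriv (p ^ n) = of_nat n * fps_deriv p * p ^ (n - 1)"
      by (simp add: fps_deriv_power fps_of_nat)
    \<comment> \<open>For n = 0 the truncated exponent n - 1 does no harm, since both sides carry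
      the factor n.\<close>
    moreover have "of_nat n * p ^ n = of_nat n * (p * p ^ (n - 1))" by (cases n) auto
    ultimately show ?thesis by (auto simp: algebra_simps)
  qed
  then have "p ^ Suc n * (fps_deriv ^^ (Suc n)) f = p * fps_deriv (p ^ n * ?g) - of_nat n * fps_deriv p * (p ^ n * ?g)"
    by simp
  also have "\<dots> \<in> Qf.rspan W"
    by (intro Qf.rspan_diff D_module_deriv[OF assms(1)] Qf.rspan_scale Qf.mult_mem Qf.of_nat_mem
          Qbar_pfps_deriv p Suc)
  finally show ?case .
qed (use assms in simp)

text \<open>The card W + 1 elements p^i f^(i) lie in a span of card W generators, so they are
  dependent over the polynomials; the relation is the differential equation once p^i is absorbed
  into its coefficient.\<close>

lemma D_module_imp_D_finite:
  assumes "D_module p W" "f \<in> Qf.rspan W"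
  shows "D_finite f"
proof -
  have p: "p \<in> Qbar_pfps" "finite W" "p \<noteq> 0" using assms(1) unfolding D_module_def by auto
  have "\<exists>c. (\<forall>i\<in>{..card W}. c i \<in> Qbar_pfps) \<and> (\<exists>i\<in>{..card W}. c i \<noteq> 0) \<and>
      (\<Sum>i\<in>{..card W}. c i * (p ^ i * (fps_deriv ^^ i) f)) = 0"
    by (rule Qf.rspan_dependent[OF p(2)]) (auto intro: D_module_higher_deriv[OF assms])
  then obtain c where c: "\<And>i. i \<le> card W \<Longrightarrow> c i \<in> Qbar_pfps" "\<exists>i\<le>card W. c i \<noteq> 0"
      "(\<Sum>i\<le>card W. c i * (p ^ i * (fps_deriv ^^ i) f)) = 0" by auto
  show ?thesis unfolding D_finite_def
  proof (rule exI[of _ "card W"], rule exI[of _ "\<lambda>k. c k * p ^ k"], intro conjI)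
    show "\<forall>k\<le>card W. c k * p ^ k \<in> Qbar_pfps" using c(1) p(1) by (auto intro!: Qf.mult_mem Qf.power_mem)
    show "\<exists>k\<le>card W. c k * p ^ k \<noteq> 0" using c(2) p(3) by auto
    show "(\<Sum>k\<le>card W. c k * p ^ k * (fps_deriv ^^ k) f) = 0" using c(3) by (simp add: mult.assoc)
  qed
qed

section \<open>D-finite series: sums, products, constants, exponentials, division by x\<close>

lemma D_finite_add:
  assumes "D_finite f" "D_finite g" shows "D_finite (f + g)"
proof -
  obtain p V where V: "D_module p V" "f \<in> Qf.rspan V" using D_finite_imp_D_module[OF assms(1)] by blast
  obtain q W where W: "D_module q W" "g \<in> Qf.rspan W" using D_finite_imp_D_module[OF assms(2)] by blast
  have pq: "p \<in> Qbar_pfps" "q \<in> Qbar_pfps" "p \<noteq> 0" "q \<noteq> 0" "finite V" "finite W"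
    using V W unfolding D_module_def by auto
  have sV: "x \<in> Qf.rspan V \<Longrightarrow> x \<in> Qf.rspan (V \<union> W)" for x
    by (rule Qf.rspan_subset, assumption, rule Qf.rspan_base) (use pq in auto)
  have sW: "x \<in> Qf.rspan W \<Longrightarrow> x \<in> Qf.rspan (V \<union> W)" for x
    by (rule Qf.rspan_subset, assumption, rule Qf.rspan_base) (use pq in auto)
  have "p * q * fps_deriv w \<in> Qf.rspan (V \<union> W)" if "w \<in> V \<union> W" for w
  proof (cases "w \<in> V")
    case True
    then have "q * (p * fps_deriv w) \<in> Qf.rspan (V \<union> W)"
      using V(1) pq unfolding D_module_def by (intro Qf.rspan_scale[of q "p * fps_deriv w"] sV) auto
    then show ?thesis by (simp add: algebra_simps)
  next
    case False
    then have "p * (q * fps_deriv w) \<in> Qf.rspan (V \<union> W)"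
      using that W(1) pq unfolding D_module_def by (intro Qf.rspan_scale[of p "q * fps_deriv w"] sW) auto
    then show ?thesis by (simp add: algebra_simps)
  qed
  then have "D_module (p * q) (V \<union> W)" using pq unfolding D_module_def by (auto intro: Qf.mult_mem)
  then show ?thesis by (rule D_module_imp_D_finite) (intro Qf.rspan_add sV sW V W)
qed

text \<open>The pairwise products of generators span a module stable under p q d/dx, by the Leibniz
  rule.\<close>

lemma D_finite_mult:
  assumes "D_finite f" "D_finite g" shows "D_finite (f * g)"
proof -
  obtain p V where V: "D_module p V" "f \<in> Qf.rspan V" using D_finite_imp_D_module[OF assms(1)] by blast
  obtain q W where W: "D_module q W" "g \<in> Qf.rspan W" using D_finite_imp_D_module[OF assms(2)] by blast
  have pq: "p \<in> Qbar_pfps" "q \<in> Qbar_pfps" "p \<noteq> 0" "q \<noteq> 0" "finite V" "finite W"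
    using V W unfolding D_module_def by auto
  define U where "U = (\<lambda>(v, w). v * w) ` (V \<times> W)"
  have "p * q * fps_deriv u \<in> Qf.rspan U" if uU: "u \<in> U" for u
  proof -
    obtain v w where vw: "u = v * w" "v \<in> V" "w \<in> W" using uU by (auto simp: U_def)
    have "p * q * fps_deriv u = q * ((p * fps_deriv v) * w) + p * (v * (q * fps_deriv w))"
      by (simp add: vw algebra_simps)
    also have "\<dots> \<in> Qf.rspan U" unfolding U_def
      by (intro Qf.rspan_add Qf.rspan_scale Qf.rspan_mult D_module_deriv[OF V(1)] D_module_deriv[OF W(1)]
          Qf.rspan_base pq vw)
    finally show ?thesis .
  qed
  then have "D_module (p * q) U" using pq unfolding D_module_def by (auto intro: Qf.mult_mem simp: U_def)
  moreover have "f * g \<in> Qf.rspan U" unfolding U_def by (intro Qf.rspan_mult pq V W)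
  ultimately show ?thesis by (rule D_module_imp_D_finite)
qed

lemma D_finite_const:
  assumes "algebraic c" shows "D_finite (fps_const c)"
proof (rule D_module_imp_D_finite)
  show "D_module 1 {1}" unfolding D_module_def by (auto simp: Qf.one_mem Qf.rspan_0)
  have "fps_const c * 1 \<in> Qf.rspan {1}" using assms
    by (intro Qf.rspan_scale Qbar_pfps_const Qf.rspan_base) auto
  then show "fps_const c \<in> Qf.rspan {1}" by simp
qed

lemma D_finite_exp:
  assumes "algebraic c" shows "D_finite (fps_exp c)"
proof (rule D_module_imp_D_finite)
  have "fps_const c * fps_exp c \<in> Qf.rspan {fps_exp c}" using assms
    by (intro Qf.rspan_scale Qbar_pfps_const Qf.rspan_base) auto
  then show "D_module 1 {fps_exp c}" unfolding D_module_def by (auto simp: Qf.one_mem)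
  show "fps_exp c \<in> Qf.rspan {fps_exp c}" by (rule Qf.rspan_base) auto
qed

lemma fps_deriv_funpow_X_mult:
  "(fps_deriv ^^ k) (fps_X * g) = fps_X * (fps_deriv ^^ k) g + of_nat k * (fps_deriv ^^ (k - 1)) (g :: complex fps)"
proof (induction k)
  case (Suc k)
  then show ?case by (cases k) (simp_all add: algebra_simps)
qed simp

lemma D_finite_X_mult_cancel:
  assumes "D_finite (fps_X * g)" shows "D_finite g"
proof -
  obtain r c where c: "\<And>k. k \<le> r \<Longrightarrow> c k \<in> Qbar_pfps" "c r \<noteq> 0"
    "(\<Sum>k\<le>r. c k * (fps_deriv ^^ k) (fps_X * g)) = 0" using D_finite_leading[OF assms] by blast
  \<comment> \<open>Since (x g)^(k) = x g^(k) + k g^(k-1), collecting the terms in g^(k) gives x c_k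
    + (k+1) c_(k+1). At k = r only x c_r remains, so the new equation is non-trivial.\<close>
  define d where "d = (\<lambda>k. fps_X * c k + (if k < r then of_nat (Suc k) * c (Suc k) else 0))"
  have "(\<Sum>k\<le>r. c k * (of_nat k * (fps_deriv ^^ (k - 1)) g)) = (\<Sum>k<r. c (Suc k) * (of_nat (Suc k) * (fps_deriv ^^ k) g))"
    by (subst sum.atMost_shift) simp
  also have "\<dots> = (\<Sum>k\<le>r. (if k < r then of_nat (Suc k) * c (Suc k) else 0) * (fps_deriv ^^ k) g)"
    by (rule sum.mono_neutral_cong_left) auto
  finally have "(\<Sum>k\<le>r. d k * (fps_deriv ^^ k) g) = (\<Sum>k\<le>r. c k * (fps_deriv ^^ k) (fps_X * g))"
    by (simp only: fps_deriv_funpow_X_mult d_def distrib_right distrib_left sum.distrib) (simp add: mult_ac)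
  then have "(\<Sum>k\<le>r. d k * (fps_deriv ^^ k) g) = 0" using c(3) by simp
  moreover have "\<forall>k\<le>r. d k \<in> Qbar_pfps" unfolding d_def using c(1)
    by (auto intro!: Qf.add_mem Qf.mult_mem Qbar_pfps_X Qf.zero_mem Qf.of_nat_mem simp del: of_nat_Suc)
  moreover have "\<exists>k\<le>r. d k \<noteq> 0" using c(2) by (intro exI[of _ r]) (simp add: d_def)
  ultimately show ?thesis unfolding D_finite_def by blast
qed

section \<open>An exponential bound for lcm(1, ..., n)\<close>

text \<open>From i binom(p^k, i) = p^k binom(p^k - 1, i - 1): if p did not divide the binomial, all
  of p^k would divide i, although 0 < i < p^k.\<close>

lemma prime_dvd_prime_power_choose:
  assumes "Factorial_Ring.prime (p :: nat)" "0 < i" "i < p ^ k"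
  shows "p dvd (p ^ k choose i)"
proof (rule ccontr)
  assume "\<not> p dvd (p ^ k choose i)"
  then have "coprime (p ^ k) (p ^ k choose i)" using assms(1) by (simp add: prime_imp_coprime)
  moreover have "p ^ k dvd i * (p ^ k choose i)"
    using times_binomial_minus1_eq[OF assms(2), of "p ^ k"] by simp
  ultimately have "p ^ k dvd i" by (simp add: coprime_dvd_mult_left_iff)
  then show False using assms by (auto dest: dvd_imp_le)
qed

text \<open>Vandermonde for 2 m = q + (2 m - q) with q = p^k: the term i = 0 vanishes because 2 m -
  q < m, and in every other term 0 < i \<le> m < q.\<close>

lemma prime_dvd_central_binomial:
  assumes "Factorial_Ring.prime (p :: nat)" "m < p ^ k" "p ^ k \<le> 2 * m"
  shows "p dvd (2 * m choose m)"
proof -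
  define q where "q = p ^ k"
  have "(2 * m choose m) = (\<Sum>i\<le>m. (q choose i) * ((2 * m - q) choose (m - i)))"
    using vandermonde[of q "2 * m - q" m] assms by (simp add: q_def)
  also have "p dvd \<dots>"
  proof (rule dvd_sum)
    fix i assume "i \<in> {..m}"
    then consider "i = 0" | "0 < i" "i < q" using assms q_def by force
    then show "p dvd (q choose i) * ((2 * m - q) choose (m - i))"
    proof cases
      case 1
      have "(2 * m - q) choose m = 0" using assms by (intro binomial_eq_0) (auto simp: q_def)
      then show ?thesis using 1 by (simp only: diff_zero mult_0_right dvd_0_right)
    qed (use prime_dvd_prime_power_choose[OF assms(1)] q_def in auto)
  qed
  finally show ?thesis .
qed

text \<open>Compared prime by prime: a prime power p^k \<le> 2 m either is at most m, or exceeds m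
  while p^(k-1) \<le> m, and then the one missing factor p comes from the central binomial
  coefficient.\<close>

lemma Lcm_double_dvd: "Lcm {1..2 * m} dvd Lcm {1..m} * (2 * m choose m :: nat)"
proof (rule Lcm_least)
  fix j assume j: "j \<in> {1..2 * m}"
  have nz: "Lcm {1..m} * (2 * m choose m) \<noteq> 0" by (auto simp: Lcm_0_iff)
  show "j dvd Lcm {1..m} * (2 * m choose m)"
  proof (rule multiplicity_le_imp_dvd)
    fix p :: nat assume p: "Factorial_Ring.prime p"
    define k where "k = multiplicity p j"
    have "p ^ k dvd j" unfolding k_def by (rule multiplicity_dvd)
    then have le: "p ^ k \<le> 2 * m" using j by (auto dest: dvd_imp_le)
    have "p ^ k dvd Lcm {1..m} * (2 * m choose m)"
    proof (cases "p ^ k \<le> m")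
      case True
      then have "p ^ k dvd Lcm {1..m}" using p by (intro dvd_Lcm) (auto simp: prime_gt_0_nat Suc_le_eq)
      then show ?thesis by simp
    next
      case False
      then obtain l where l: "k = Suc l" using le j by (cases k) auto
      have "2 * p ^ l \<le> p ^ k" using prime_ge_2_nat[OF p] l by simp
      then have "p ^ l \<le> m" using le by simp
      then have "p ^ l dvd Lcm {1..m}" using p by (intro dvd_Lcm) (auto simp: prime_gt_0_nat Suc_le_eq)
      moreover have "p dvd (2 * m choose m)" using prime_dvd_central_binomial[OF p, of m k] False le by simp
      ultimately have "p * p ^ l dvd (2 * m choose m) * Lcm {1..m}" by (intro mult_dvd_mono)
      then show ?thesis unfolding l power_Suc by (simp only: mult.commute)
    qed
    then show "multiplicity p j \<le> multiplicity p (Lcm {1..m} * (2 * m choose m))"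
      unfolding k_def[symmetric] using nz p by (intro multiplicity_geI) auto
  qed (use j in auto)
qed

lemma Lcm_le_16_power: "Lcm {1..n} \<le> (16 :: nat) ^ n"
proof (induction n rule: less_induct)
  case (less n)
  show ?case
  proof (cases "n \<le> 1")
    case True
    then have "n = 0 \<or> n = 1" by auto
    then show ?thesis by auto
  next
    case False
    define m where "m = (n + 1) div 2"
    have m: "m < n" "n \<le> 2 * m" "2 * m \<le> n + 1" using False unfolding m_def by linarith+
    have pos: "0 < Lcm {1..k :: nat}" for k by (rule Nat.gr0I) (auto simp: Lcm_0_iff)
    have "Lcm {1..n} \<le> Lcm {1..2 * m}" by (rule dvd_imp_le[OF Lcm_subset pos]) (use m in auto)
    also have "\<dots> \<le> Lcm {1..m} * (2 * m choose m)"
      by (rule dvd_imp_le[OF Lcm_double_dvd]) (use pos[of m] in simp)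
    also have "\<dots> \<le> 16 ^ m * 2 ^ (2 * m)" by (rule mult_le_mono[OF less[OF m(1)] binomial_le_pow2])
    also have "\<dots> = 2 ^ (6 * m)" by (simp add: power_mult power_mult_distrib[symmetric])
    \<comment> \<open>This needs 6 m \<le> 4 n. Equality holds for n = 3, m = 2, which is where the
      base 16 comes from.\<close>
    also have "\<dots> \<le> 2 ^ (4 * n)" using m False by (intro power_increasing) auto
    also have "\<dots> = 16 ^ n" by (simp add: power_mult)
    finally show ?thesis .
  qed
qed

section \<open>Closure properties of E-functions\<close>

lemma E_functionI:
  assumes "\<And>n. algebraic (egf_coeff f n)" "D_finite f"
    and "\<And>\<sigma> n. galois_aut \<sigma> \<Longrightarrow> norm (\<sigma> (egf_coeff f n)) \<le> A ^ (n + 1)" "0 < A"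
    and "\<And>n. 0 < d n" "\<And>n. real (d n) \<le> B ^ (n + 1)" "0 < B"
      "\<And>n m. m \<le> n \<Longrightarrow> algebraic_int (of_nat (d n) * egf_coeff f m)"
  shows "E_function f"
  unfolding E_function_def satisfies_linear_ODE_iff galois_conjugates_def
  using assms by (intro conjI exI[of _ A] exI[of _ B] exI[of _ d]) auto

lemma E_functionE:
  assumes "E_function f"
  obtains C1 C2 d where "\<And>n. algebraic (egf_coeff f n)" "D_finite f"
    "\<And>\<sigma> n. galois_aut \<sigma> \<Longrightarrow> norm (\<sigma> (egf_coeff f n)) \<le> C1 ^ (n + 1)" "0 < C1"
    "\<And>n. 0 < d n" "\<And>n. real (d n) \<le> C2 ^ (n + 1)" "0 < C2"
    "\<And>n m. m \<le> n \<Longrightarrow> algebraic_int (of_nat (d n) * egf_coeff f m)"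
proof -
  from assms obtain C1 where C1: "\<And>n. algebraic (egf_coeff f n)" "D_finite f" "0 < C1"
    "\<forall>n. \<forall>b\<in>galois_conjugates (egf_coeff f n). norm b \<le> C1 ^ (n + 1)"
    unfolding E_function_def satisfies_linear_ODE_iff by auto
  from assms obtain C2 d where "0 < C2" "\<forall>n. 0 < d n \<and> real (d n) \<le> C2 ^ (n + 1) \<and>
        (\<forall>m\<le>n. algebraic_int (of_nat (d n) * egf_coeff f m))"
    unfolding E_function_def by auto
  moreover have "norm (\<sigma> (egf_coeff f n)) \<le> C1 ^ (n + 1)" if "galois_aut \<sigma>" for \<sigma> n
    using C1(4) that unfolding galois_conjugates_def by blast
  ultimately show ?thesis using C1(1-3) by (intro that[of C1 d C2]) simp_all
qed

lemma egf_coeff_add: "egf_coeff (f + g) n = egf_coeff f n + egf_coeff g n"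
  by (simp add: egf_coeff_def algebra_simps)

text \<open>With the factorials removed, a product becomes a binomial convolution. Its weights are
  integers, so multiplication creates no denominators of its own.\<close>

lemma egf_coeff_mult:
  "egf_coeff (f * g) n = (\<Sum>k\<le>n. of_nat (n choose k) * (egf_coeff f k * egf_coeff g (n - k)))"
  unfolding egf_coeff_def fps_mult_nth sum_distrib_left atLeast0AtMost
  by (rule sum.cong) (auto simp: binomial_fact field_simps)

lemma egf_coeff_const: "egf_coeff (fps_const c) n = (if n = 0 then c else 0)"
  by (simp add: egf_coeff_def)

lemma egf_coeff_exp: "egf_coeff (fps_exp c) n = c ^ n"
  by (simp add: egf_coeff_def)

lemma egf_coeff_X_mult: "egf_coeff g n = egf_coeff (fps_X * g) (Suc n) / of_nat (Suc n)"
  by (simp add: egf_coeff_def field_simps del: of_nat_Suc)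

lemma E_function_add:
  assumes "E_function f" "E_function g"
  shows "E_function (f + g)"
proof -
  obtain C1 C2 d where f: "\<And>n. algebraic (egf_coeff f n)" "D_finite f"
    "\<And>\<sigma> n. galois_aut \<sigma> \<Longrightarrow> norm (\<sigma> (egf_coeff f n)) \<le> C1 ^ (n + 1)" "0 < C1"
    "\<And>n. 0 < d n" "\<And>n. real (d n) \<le> C2 ^ (n + 1)" "0 < C2"
    "\<And>n m. m \<le> n \<Longrightarrow> algebraic_int (of_nat (d n) * egf_coeff f m)" using E_functionE[OF assms(1)] by metis
  obtain D1 D2 e where g: "\<And>n. algebraic (egf_coeff g n)" "D_finite g"
    "\<And>\<sigma> n. galois_aut \<sigma> \<Longrightarrow> norm (\<sigma> (egf_coeff g n)) \<le> D1 ^ (n + 1)" "0 < D1"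
    "\<And>n. 0 < e n" "\<And>n. real (e n) \<le> D2 ^ (n + 1)" "0 < D2"
    "\<And>n m. m \<le> n \<Longrightarrow> algebraic_int (of_nat (e n) * egf_coeff g m)" using E_functionE[OF assms(2)] by metis
  show ?thesis
  proof (rule E_functionI)
    fix \<sigma> n assume s: "galois_aut \<sigma>"
    have "norm (\<sigma> (egf_coeff (f + g) n)) \<le> C1 ^ (n + 1) + D1 ^ (n + 1)"
      unfolding egf_coeff_add galois_aut_add[OF s f(1) g(1)]
      by (rule norm_triangle_mono[OF f(3)[OF s] g(3)[OF s]])
    also have "\<dots> \<le> (C1 + D1) ^ (n + 1)"
    proof -
      have "C1 * C1 ^ n \<le> C1 * (C1 + D1) ^ n" "D1 * D1 ^ n \<le> D1 * (C1 + D1) ^ n"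
        using f(4) g(4) by (intro mult_left_mono power_mono; simp)+
      then show ?thesis by (simp add: algebra_simps)
    qed
    finally show "norm (\<sigma> (egf_coeff (f + g) n)) \<le> (C1 + D1) ^ (n + 1)" .
  next
    fix n
    show "real (d n * e n) \<le> (C2 * D2) ^ (n + 1)"
      unfolding power_mult_distrib of_nat_mult using f(6,7) g(6,7) by (intro mult_mono) auto
  next
    fix n m :: nat assume m: "m \<le> n"
    have "of_nat (d n * e n) * egf_coeff (f + g) m =
       of_nat (e n) * (of_nat (d n) * egf_coeff f m) + of_nat (d n) * (of_nat (e n) * egf_coeff g m)"
      by (simp add: egf_coeff_add algebra_simps)
    also have "algebraic_int \<dots>"
      by (rule algebraic_int_plus; rule algebraic_int_of_nat_mult) (use f g m in auto)
    finally show "algebraic_int (of_nat (d n * e n) * egf_coeff (f + g) m)" .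
  qed (use f g in \<open>auto simp: egf_coeff_add intro: algebraic_plus D_finite_add\<close>)
qed

lemma E_function_mult:
  assumes "E_function f" "E_function g"
  shows "E_function (f * g)"
proof -
  obtain C1 C2 d where f: "\<And>n. algebraic (egf_coeff f n)" "D_finite f"
    "\<And>\<sigma> n. galois_aut \<sigma> \<Longrightarrow> norm (\<sigma> (egf_coeff f n)) \<le> C1 ^ (n + 1)" "0 < C1"
    "\<And>n. 0 < d n" "\<And>n. real (d n) \<le> C2 ^ (n + 1)" "0 < C2"
    "\<And>n m. m \<le> n \<Longrightarrow> algebraic_int (of_nat (d n) * egf_coeff f m)" using E_functionE[OF assms(1)] by metis
  obtain D1 D2 e where g: "\<And>n. algebraic (egf_coeff g n)" "D_finite g"
    "\<And>\<sigma> n. galois_aut \<sigma> \<Longrightarrow> norm (\<sigma> (egf_coeff g n)) \<le> D1 ^ (n + 1)" "0 < D1"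
    "\<And>n. 0 < e n" "\<And>n. real (e n) \<le> D2 ^ (n + 1)" "0 < D2"
    "\<And>n m. m \<le> n \<Longrightarrow> algebraic_int (of_nat (e n) * egf_coeff g m)" using E_functionE[OF assms(2)] by metis
  have alg: "algebraic (of_nat (n choose k) * (egf_coeff f i * egf_coeff g j))" for n k i j
    using Qb.of_nat_mem by (intro algebraic_times f g) auto
  \<comment> \<open>By the binomial theorem the bound on the n-th coefficient will be C1 D1 (C1 +
    D1)^n; K dominates both C1 D1 and C1 + D1.\<close>
  define K where "K = C1 * D1 + C1 + D1"
  show ?thesis
  proof (rule E_functionI)
    fix \<sigma> n assume s: "galois_aut \<sigma>"
    have "\<sigma> (egf_coeff (f * g) n) = (\<Sum>k\<le>n. of_nat (n choose k) * (\<sigma> (egf_coeff f k) * \<sigma> (egf_coeff g (n - k))))"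
      unfolding egf_coeff_mult using Qb.of_nat_mem f(1) g(1)
      by (subst galois_aut_sum[OF s alg])
         (simp add: galois_aut_mult[OF s] algebraic_times galois_aut_of_nat[OF s])
    also have "norm \<dots> \<le> (\<Sum>k\<le>n. real (n choose k) * (C1 ^ (k + 1) * D1 ^ (n - k + 1)))"
      by (rule sum_norm_le) (use f(3)[OF s] f(4) g(3)[OF s] g(4) in
        \<open>auto simp: norm_mult intro!: mult_left_mono mult_mono simp del: power_Suc\<close>)
    also have "\<dots> = C1 * D1 * (\<Sum>k\<le>n. real (n choose k) * C1 ^ k * D1 ^ (n - k))"
      unfolding sum_distrib_left by (rule sum.cong) (auto simp: algebra_simps)
    also have "(\<Sum>k\<le>n. real (n choose k) * C1 ^ k * D1 ^ (n - k)) = (C1 + D1) ^ n"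
      by (rule binomial_ring[symmetric])
    also have "C1 * D1 * (C1 + D1) ^ n \<le> K * K ^ n"
      using f(4) g(4) unfolding K_def by (intro mult_mono power_mono) auto
    finally show "norm (\<sigma> (egf_coeff (f * g) n)) \<le> K ^ (n + 1)" by simp
  next
    fix n
    show "real (d n * e n) \<le> (C2 * D2) ^ (n + 1)"
      unfolding power_mult_distrib of_nat_mult using f(6,7) g(6,7) by (intro mult_mono) auto
  next
    fix n m :: nat assume m: "m \<le> n"
    \<comment> \<open>Both k and m - k are at most n, so the same product of denominators clears
      every term of the convolution.\<close>
    have "of_nat (d n * e n) * egf_coeff (f * g) m =
       (\<Sum>k\<le>m. of_nat (m choose k) * ((of_nat (d n) * egf_coeff f k) * (of_nat (e n) * egf_coeff g (m - k))))"
      by (simp add: egf_coeff_mult sum_distrib_left algebra_simps)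
    also have "algebraic_int \<dots>"
      by (rule algebraic_int_sum, rule algebraic_int_of_nat_mult, rule algebraic_int_times) (use f g m in auto)
    finally show "algebraic_int (of_nat (d n * e n) * egf_coeff (f * g) m)" .
  next
    show "algebraic (egf_coeff (f * g) n)" for n
      unfolding egf_coeff_mult using Qb.sum_mem[of "{..n}"] alg by simp
    show "0 < K" using f(4) g(4) unfolding K_def by (simp add: add_pos_pos)
  qed (use f g in \<open>auto intro: D_finite_mult\<close>)
qed

lemma E_function_const:
  assumes "algebraic c" shows "E_function (fps_const c)"
proof -
  obtain k :: nat where k: "0 < k" "algebraic_int (of_nat k * c)" using algebraic_imp_multiple_int[OF assms] by blast
  obtain C where C: "0 < C" "\<And>\<sigma>. galois_aut \<sigma> \<Longrightarrow> norm (\<sigma> c) \<le> C" using bounded_galois_conjugates[OF assms] by blast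
  show ?thesis
  proof (rule E_functionI[where d = "\<lambda>_. k" and A = C and B = "real k"])
    show "norm (\<sigma> (egf_coeff (fps_const c) n)) \<le> C ^ (n + 1)" if "galois_aut \<sigma>" for \<sigma> n
      using C that by (auto simp: egf_coeff_const galois_aut_0)
    show "real k \<le> real k ^ (n + 1)" for n using k(1) self_le_power[of "real k" "n + 1"] by simp
  qed (use k C assms in \<open>auto simp: egf_coeff_const intro: D_finite_const\<close>)
qed

lemma E_function_exp:
  assumes "algebraic c" shows "E_function (fps_exp c)"
proof -
  obtain k :: nat where k: "0 < k" "algebraic_int (of_nat k * c)" using algebraic_imp_multiple_int[OF assms] by blast
  obtain C where C: "0 < C" "\<And>\<sigma>. galois_aut \<sigma> \<Longrightarrow> norm (\<sigma> c) \<le> C" using bounded_galois_conjugates[OF assms] by blast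
  show ?thesis
  \<comment> \<open>The base C + 1 exceeds 1, which allows the exponent n to be raised to n +
    1.\<close>
  proof (rule E_functionI[where d = "\<lambda>n. k ^ n" and A = "C + 1" and B = "real k"])
    fix \<sigma> n assume s: "galois_aut \<sigma>"
    have "norm (\<sigma> (egf_coeff (fps_exp c) n)) = norm (\<sigma> c) ^ n"
      by (simp add: egf_coeff_exp galois_aut_power[OF s assms] norm_power)
    also have "\<dots> \<le> (C + 1) ^ n" using C(2)[OF s] by (intro power_mono) auto
    also have "\<dots> \<le> (C + 1) ^ (n + 1)" using C(1) by (intro power_increasing) auto
    finally show "norm (\<sigma> (egf_coeff (fps_exp c) n)) \<le> (C + 1) ^ (n + 1)" .
  next
    show "real (k ^ n) \<le> real k ^ (n + 1)" for n using k(1) power_increasing[of n "n + 1" "real k"] by simp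
    show "algebraic_int (of_nat (k ^ n) * egf_coeff (fps_exp c) m)" if "m \<le> n" for n m
    proof -
      have "of_nat (k ^ n) * egf_coeff (fps_exp c) m = of_nat (k ^ (n - m)) * (of_nat k * c) ^ m"
        using that by (simp add: egf_coeff_exp power_mult_distrib mult.assoc[symmetric] flip: power_add)
      then show ?thesis by (simp only:) (rule algebraic_int_of_nat_mult[OF algebraic_int_power[OF k(2)]])
    qed
  qed (use k C assms Qb.power_mem in \<open>auto simp: egf_coeff_exp intro: D_finite_exp\<close>)
qed

text \<open>The new denominators \<open>n + 1\<close> are absorbed by \<open>lcm(1, \<dots>, n + 1)\<close>, which grows geometrically.\<close>
lemma E_function_X_mult_cancel:
  assumes "E_function (fps_X * g)" shows "E_function g"
proof -
  let ?f = "fps_X * g"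
  obtain C1 C2 d where f: "\<And>n. algebraic (egf_coeff ?f n)" "D_finite ?f"
    "\<And>\<sigma> n. galois_aut \<sigma> \<Longrightarrow> norm (\<sigma> (egf_coeff ?f n)) \<le> C1 ^ (n + 1)" "0 < C1"
    "\<And>n. 0 < d n" "\<And>n. real (d n) \<le> C2 ^ (n + 1)" "0 < C2"
    "\<And>n m. m \<le> n \<Longrightarrow> algebraic_int (of_nat (d n) * egf_coeff ?f m)" using E_functionE[OF assms(1)] by metis
  \<comment> \<open>The n-th coefficient of g comes from the coefficient of index n + 1 of x g, so
    bounds appear with exponent n + 2. Passing to the base (x + 1)^2 restores the exponent n +
    1.\<close>
  have square: "x ^ (n + 2) \<le> ((x + 1) ^ 2) ^ (n + 1)" if "0 < x" for x :: real and n
  proof -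
    have "x ^ (n + 2) \<le> (x + 1) ^ (n + 2)" using that by (intro power_mono) auto
    also have "\<dots> \<le> (x + 1) ^ (2 * (n + 1))" using that by (intro power_increasing) auto
    finally show ?thesis by (simp only: power_mult)
  qed
  show ?thesis
  proof (rule E_functionI[where d = "\<lambda>n. Lcm {1..n + 1} * d (n + 1)"])
    have "algebraic (1 / of_nat (Suc n) :: complex)" for n
      using Qbar_of_rat[of "1 / of_nat (Suc n)"] by (simp add: of_rat_divide del: of_nat_Suc)
    moreover have "egf_coeff g n = 1 / of_nat (Suc n) * egf_coeff ?f (Suc n)" for n
      unfolding egf_coeff_X_mult[of g] by simp
    ultimately show "algebraic (egf_coeff g n)" for n
      using algebraic_times f(1) by metis
    show "D_finite g" by (rule D_finite_X_mult_cancel[OF f(2)])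
    fix \<sigma> n assume s: "galois_aut \<sigma>"
    have "norm (\<sigma> (egf_coeff g n)) = norm (\<sigma> (egf_coeff ?f (Suc n))) / real (Suc n)"
      unfolding egf_coeff_X_mult[of g] galois_aut_divide_of_nat[OF s f(1)] norm_divide norm_of_nat ..
    also have "\<dots> \<le> norm (\<sigma> (egf_coeff ?f (Suc n))) / 1" by (intro divide_left_mono) auto
    also have "\<dots> \<le> C1 ^ (n + 2)" using f(3)[OF s, of "Suc n"] by simp
    also have "\<dots> \<le> ((C1 + 1) ^ 2) ^ (n + 1)" by (rule square[OF f(4)])
    finally show "norm (\<sigma> (egf_coeff g n)) \<le> ((C1 + 1) ^ 2) ^ (n + 1)" .
  next
    fix n
    show "0 < Lcm {1..n + 1} * d (n + 1)" using f(5) by (auto simp: Lcm_0_iff intro!: Nat.gr0I)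
    have "real (Lcm {1..n + 1}) \<le> real (16 ^ (n + 1))" using Lcm_le_16_power of_nat_le_iff by blast
    then have "real (Lcm {1..n + 1} * d (n + 1)) \<le> 16 ^ (n + 1) * C2 ^ (n + 2)"
      unfolding of_nat_mult using f(6)[of "n + 1"] by (intro mult_mono) (auto simp: f(7) less_imp_le)
    also have "\<dots> \<le> 16 ^ (n + 1) * ((C2 + 1) ^ 2) ^ (n + 1)"
      using square[OF f(7), of n] by (intro mult_left_mono) auto
    also have "\<dots> = (16 * (C2 + 1) ^ 2) ^ (n + 1)" by (rule power_mult_distrib[symmetric])
    finally show "real (Lcm {1..n + 1} * d (n + 1)) \<le> (16 * (C2 + 1) ^ 2) ^ (n + 1)" .
  next
    fix n m :: nat assume m: "m \<le> n"
    have "Suc m dvd Lcm {1..n + 1}" using m by (intro dvd_Lcm) auto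
    then obtain k where k: "Lcm {1..n + 1} = Suc m * k" by (elim dvdE)
    have "of_nat (Lcm {1..n + 1} * d (n + 1)) * egf_coeff g m =
        of_nat k * (of_nat (d (n + 1)) * egf_coeff ?f (Suc m))"
    proof -
      define c :: complex where "c = of_nat (Suc m)"
      have "c \<noteq> 0" unfolding c_def by (simp del: of_nat_Suc)
      then show ?thesis
        unfolding k egf_coeff_X_mult[of g] of_nat_mult c_def[symmetric] by (simp add: field_simps)
    qed
    also have "algebraic_int \<dots>"
      by (rule algebraic_int_of_nat_mult, rule f(8)) (use m in simp)
    finally show "algebraic_int (of_nat (Lcm {1..n + 1} * d (n + 1)) * egf_coeff g m)" .
  qed (use f(4,7) in auto)
qed

lemma E_function_X_power_mult_cancel: "E_function (fps_X ^ n * g) \<Longrightarrow> E_function g"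
  by (induction n) (auto simp: mult.assoc dest: E_function_X_mult_cancel)

lemma E_function_uminus: "E_function f \<Longrightarrow> E_function (- f)"
  using E_function_mult[OF E_function_const[of "-1"], of f] by (simp flip: fps_const_neg)

lemma E_ring_simps [simp]:
  "carrier E_ring = {f. E_function f}" "mult E_ring = (*)" "one E_ring = 1"
  "zero E_ring = 0" "add E_ring = (+)"
  by (simp_all add: E_ring_def)

lemma E_function_0: "E_function 0" and E_function_1: "E_function 1"
  using E_function_const[of 0] E_function_const[of 1] by simp_all

interpretation E: domain E_ring
proof (rule domainI)
  show "cring E_ring"
  proof (rule cringI)
    show "abelian_group E_ring"
      by (rule abelian_groupI)
         (auto simp: E_function_add E_function_0 algebra_simps intro: E_function_uminus exI[of _ "- x" for x])
    show "comm_monoid E_ring"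
      by (rule comm_monoidI) (auto simp: E_function_mult E_function_1 algebra_simps)
  qed (auto simp: algebra_simps)
qed auto

section \<open>The halving chain\<close>

text \<open>Condition (ii) for the identity automorphism bounds the n-th Taylor coefficient by
  C1^(n+1) / n!; comparison with an exponential series does the rest.\<close>

lemma fps_conv_radius_E_function:
  assumes "E_function f" shows "fps_conv_radius f = \<infinity>"
proof -
  obtain C1 where C: "\<And>n. norm (egf_coeff f n) \<le> C1 ^ (n + 1)" "0 < C1"
    using E_functionE[OF assms] galois_aut_id by metis
  show ?thesis unfolding fps_conv_radius_def
  proof (rule conv_radius_inftyI'')
    fix z :: complex
    have "summable (\<lambda>n. C1 * (inverse (fact n) *\<^sub>R (C1 * norm z) ^ n))"
      by (intro summable_mult summable_exp_generic)
    then show "summable (\<lambda>n. fps_nth f n * z ^ n)"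
    proof (rule summable_comparison_test'[where N = 0])
      fix n
      have "norm (fps_nth f n * z ^ n) = norm (egf_coeff f n) / fact n * norm z ^ n"
        by (simp add: egf_coeff_def norm_mult norm_power)
      also have "\<dots> \<le> C1 ^ (n + 1) / fact n * norm z ^ n"
        by (intro mult_right_mono divide_right_mono C) auto
      also have "\<dots> = C1 * (inverse (fact n) *\<^sub>R (C1 * norm z) ^ n)"
        by (simp add: field_simps)
      finally show "norm (fps_nth f n * z ^ n) \<le> C1 * (inverse (fact n) *\<^sub>R (C1 * norm z) ^ n)" .
    qed
  qed
qed

text \<open>Infinite radius of convergence makes evaluation multiplicative at every point, so g f =
  1 excludes zeros of f.\<close>

lemma E_unit_no_zero:
  assumes "f \<in> Units E_ring" shows "eval_fps f z \<noteq> 0"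
proof
  assume z: "eval_fps f z = 0"
  obtain g where g: "E_function f" "E_function g" "g * f = 1" using assms unfolding Units_def by auto
  have "eval_fps (g * f) z = eval_fps g z * eval_fps f z"
    by (rule eval_fps_mult) (auto simp: fps_conv_radius_E_function g)
  then show False using z g by simp
qed

definition expm1_half :: "nat \<Rightarrow> complex fps" where
  "expm1_half k = fps_exp (1 / 2 ^ k) - 1"

definition expp1_half :: "nat \<Rightarrow> complex fps" where
  "expp1_half k = fps_exp (1 / 2 ^ k) + 1"

lemma algebraic_inverse_two_power: "algebraic (1 / 2 ^ k :: complex)"
  using Qbar_of_rat[of "1 / 2 ^ k"] by (simp add: of_rat_divide of_rat_power)

lemma E_function_expm1_half: "E_function (expm1_half k)"
  using E_function_add[OF E_function_exp[OF algebraic_inverse_two_power] E_function_uminus[OF E_function_1]]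
  by (simp add: expm1_half_def)

lemma E_function_expp1_half: "E_function (expp1_half k)"
  unfolding expp1_half_def by (intro E_function_add E_function_exp E_function_1 algebraic_inverse_two_power)

lemma expm1_half_nonzero: "expm1_half k \<noteq> 0"
proof
  assume "expm1_half k = 0"
  then have "fps_nth (expm1_half k) 1 = 0" by simp
  then show False by (simp add: expm1_half_def)
qed

lemma expm1_half_Suc: "expm1_half k = expm1_half (Suc k) * expp1_half (Suc k)"
proof -
  have "fps_exp (1 / 2 ^ k) = fps_exp (1 / 2 ^ Suc k) * fps_exp (1 / 2 ^ Suc k :: complex)"
    by (simp add: fps_exp_add_mult[symmetric])
  then show ?thesis by (simp add: expm1_half_def expp1_half_def algebra_simps)
qed

lemma expp1_half_not_unit: "expp1_half k \<notin> Units E_ring"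
proof
  assume "expp1_half k \<in> Units E_ring"
  \<comment> \<open>The point is chosen so that, divided by 2^k, it is \<pi> i, where the
    exponential is -1.\<close>
  then have "eval_fps (expp1_half k) (of_real pi * \<i> * 2 ^ k) \<noteq> 0" by (rule E_unit_no_zero)
  moreover have "eval_fps (expp1_half k) (of_real pi * \<i> * 2 ^ k) = exp (of_real pi * \<i>) + 1"
    unfolding expp1_half_def by (subst eval_fps_add) auto
  ultimately show False by simp
qed

text \<open>Otherwise substituting \<open>expm1_half_Suc\<close> and cancelling would exhibit g as
  an inverse of the non-unit \<open>expp1_half (Suc k)\<close>.\<close>

lemma expm1_half_not_divides_Suc: "\<not> (\<exists>g. E_function g \<and> expm1_half (Suc k) = expm1_half k * g)"
proof safe
  fix g assume g: "E_function g" "expm1_half (Suc k) = expm1_half k * g"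
  then have "expm1_half (Suc k) * 1 = expm1_half (Suc k) * (expp1_half (Suc k) * g)"
    by (metis expm1_half_Suc mult.assoc mult.right_neutral)
  then have "expp1_half (Suc k) * g = 1"
    using expm1_half_nonzero[of "Suc k"] by (simp only: mult_cancel_left) auto
  then have "expp1_half (Suc k) \<in> Units E_ring" using g E_function_expp1_half[of "Suc k"]
    by (auto simp: Units_def intro!: bexI[of _ g] exI[of _ g] simp: mult.commute)
  then show False using expp1_half_not_unit by blast
qed

text \<open>In a noetherian ring the union of a chain of ideals is one of its members, say
  \<open>I k\<close>; but the generator of \<open>I (Suc k)\<close> does not lie in
  \<open>I k\<close>.\<close>

lemma E_ring_not_noetherian: "\<not> noetherian_ring E_ring"
proof
  assume "noetherian_ring E_ring"
  then interpret noetherian_ring E_ring .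
  define I where "I = (\<lambda>k. PIdl\<^bsub>E_ring\<^esub> (expm1_half k))"
  have I: "I k = {x * expm1_half k | x. E_function x}" for k by (auto simp: I_def cgenideal_def)
  have "I k \<subseteq> I (Suc k)" for k
  proof
    fix x assume "x \<in> I k"
    then obtain y where "x = y * expm1_half k" "E_function y" unfolding I by auto
    then have "x = (y * expp1_half (Suc k)) * expm1_half (Suc k)" "E_function (y * expp1_half (Suc k))"
      using E_function_mult E_function_expp1_half by (simp_all add: expm1_half_Suc[of k] mult_ac)
    then show "x \<in> I (Suc k)" unfolding I by blast
  qed
  then have mono: "i \<le> j \<Longrightarrow> I i \<subseteq> I j" for i j by (rule lift_Suc_mono_le)
  have "subset.chain {J. ideal J E_ring} (range I)"
    unfolding subset_chain_def
  proof (intro conjI ballI)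
    show "range I \<subseteq> {J. ideal J E_ring}" by (auto simp: I_def E_function_expm1_half intro!: E.cgenideal_ideal)
    fix x y assume "x \<in> range I" "y \<in> range I"
    then obtain i j where "x = I i" "y = I j" by auto
    then show "x \<subseteq> y \<or> y \<subseteq> x" using mono[of i j] mono[of j i] by (cases "i \<le> j") auto
  qed
  then have "\<Union>(range I) \<in> range I" by (intro ideal_chain_is_trivial) auto
  then obtain k where "\<Union>(range I) = I k" by auto
  moreover have "expm1_half (Suc k) \<in> I (Suc k)" unfolding I using E_function_1 by (auto intro!: exI[of _ 1])
  ultimately have "expm1_half (Suc k) \<in> I k" by auto
  then show False using expm1_half_not_divides_Suc[of k] unfolding I by (auto simp: mult.commute)
qed

text \<open>Proper divisibility is well-founded in a factorial monoid, here the non-zero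
  E-functions, whereas the halving chain descends for ever.\<close>

lemma E_ring_not_factorial: "\<not> factorial_domain E_ring"
proof
  assume "factorial_domain E_ring"
  then interpret F: factorial_monoid "mult_of E_ring" unfolding factorial_domain_def by blast
  have "wf {(x, y). x \<in> carrier (mult_of E_ring) \<and> y \<in> carrier (mult_of E_ring) \<and> properfactor (mult_of E_ring) x y}"
    by (rule F.division_wellfounded)
  moreover have "properfactor (mult_of E_ring) (expm1_half (Suc k)) (expm1_half k)" for k
  proof -
    have "expp1_half (Suc k) \<noteq> 0" using expm1_half_Suc[of k] expm1_half_nonzero[of k] by auto
    then have "expm1_half (Suc k) divides\<^bsub>mult_of E_ring\<^esub> expm1_half k"
      unfolding factor_def using E_function_expp1_half expm1_half_Suc[of k] by auto
    moreover have "\<not> expm1_half k divides\<^bsub>mult_of E_ring\<^esub> expm1_half (Suc k)"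
      using expm1_half_not_divides_Suc[of k] unfolding factor_def by auto
    ultimately show ?thesis unfolding properfactor_def by blast
  qed
  moreover have "expm1_half k \<in> carrier (mult_of E_ring)" for k
    using E_function_expm1_half expm1_half_nonzero by simp
  ultimately show False unfolding wf_iff_no_infinite_down_chain by blast
qed

section \<open>Linear independence of exponentials over the polynomials\<close>

text \<open>The operator that d/dx induces on the polynomial factor p of p e^(d x).\<close>

definition twisted_pderiv :: "complex \<Rightarrow> complex poly \<Rightarrow> complex poly" where
  "twisted_pderiv d p = pderiv p + smult d p"

lemma fps_deriv_poly_times_exp:
  "(fps_deriv ^^ n) (fps_of_poly p * fps_exp d) = fps_of_poly ((twisted_pderiv d ^^ n) p) * fps_exp d"
  by (induction n) (simp_all add: twisted_pderiv_def fps_of_poly_add fps_of_poly_pderiv fps_of_poly_smult algebra_simps)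

text \<open>As p' has lower degree than p, the leading coefficient is multiplied by d; for d
  \<noteq> 0 the operator is therefore injective.\<close>

lemma twisted_pderiv_funpow_eq_0:
  assumes "d \<noteq> 0" "(twisted_pderiv d ^^ n) p = 0" shows "p = 0"
  using assms(2)
proof (induction n)
  case (Suc n)
  have "q = 0" if "twisted_pderiv d q = 0" for q
  proof (rule ccontr)
    assume q: "q \<noteq> 0"
    have "pderiv q = smult (- d) q" using that by (simp add: twisted_pderiv_def eq_neg_iff_add_eq_0)
    then have "poly.coeff (pderiv q) (degree q) \<noteq> 0" using q assms(1) by simp
    then show False by (simp add: coeff_pderiv coeff_eq_0)
  qed
  then show ?case using Suc by simp
qed simp

lemma pderiv_funpow_eq_0: "degree (p :: complex poly) < n \<Longrightarrow> (pderiv ^^ n) p = 0"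
proof (induction n arbitrary: p)
  case (Suc n)
  have zero: "(pderiv ^^ m) (0 :: complex poly) = 0" for m by (induction m) auto
  show ?case
  proof (cases "degree p = 0")
    case True
    then show ?thesis using zero by (simp add: funpow_Suc_right pderiv_eq_0_iff[THEN iffD2] del: funpow.simps)
  next
    case False
    then have "degree (pderiv p) < n" using Suc.prems by (simp add: degree_pderiv)
    from Suc.IH[OF this] show ?thesis by (simp add: funpow_Suc_right del: funpow.simps)
  qed
qed simp

lemma fps_deriv_funpow_sum:
  "(fps_deriv ^^ n) (\<Sum>i\<in>I. f i) = (\<Sum>i\<in>I. (fps_deriv ^^ n) (f i :: complex fps))"
  by (induction n) (auto simp: fps_deriv_sum)

text \<open>
  Multiplying by \<open>e\<^sup>-\<^sup>b\<^sup>x\<close> turns one term of the relation into a polynomial, which is then killed by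
  sufficiently many derivatives; on the other terms these derivatives act injectively on the
  polynomial coefficients.
\<close>
lemma exp_poly_linear_independent:
  fixes P :: "complex \<Rightarrow> complex poly"
  assumes "finite A" "(\<Sum>c\<in>A. fps_of_poly (P c) * fps_exp c) = 0"
  shows "\<forall>c\<in>A. P c = 0"
  using assms
proof (induction A arbitrary: P rule: finite_induct)
  case (insert b A)
  \<comment> \<open>One derivative more than the degree, just enough to annihilate
    \<open>P b\<close>.\<close>
  define n where "n = Suc (degree (P b))"
  have exp: "fps_exp c = fps_exp (c - b) * fps_exp b" for c :: complex
    by (simp add: fps_exp_add_mult[symmetric])
  have "0 = (\<Sum>c\<in>insert b A. fps_of_poly (P c) * (fps_exp (c - b) * fps_exp b))"
    using insert.prems by (simp only: exp[symmetric])
  also have "\<dots> = fps_exp b * (fps_of_poly (P b) * fps_exp 0 + (\<Sum>c\<in>A. fps_of_poly (P c) * fps_exp (c - b)))"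
    using insert.hyps by (simp add: sum_distrib_left algebra_simps)
  finally have "fps_of_poly (P b) * fps_exp 0 + (\<Sum>c\<in>A. fps_of_poly (P c) * fps_exp (c - b)) = 0"
    by simp
  then have "(fps_deriv ^^ n) (fps_of_poly (P b) * fps_exp 0 + (\<Sum>c\<in>A. fps_of_poly (P c) * fps_exp (c - b))) = 0"
    by (simp only:) (induction n, auto)
  moreover have "(fps_deriv ^^ n) (f + g) = (fps_deriv ^^ n) f + (fps_deriv ^^ n) g" for f g :: "complex fps"
    by (induction n) auto
  moreover have "(twisted_pderiv 0 ^^ n) (P b) = 0"
  proof -
    have "twisted_pderiv 0 = pderiv" by (rule ext) (simp add: twisted_pderiv_def)
    then show ?thesis using pderiv_funpow_eq_0[of "P b" n] by (simp only: n_def lessI)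
  qed
  ultimately have "(\<Sum>c\<in>A. fps_of_poly ((twisted_pderiv (c - b) ^^ n) (P c)) * fps_exp (c - b)) = 0"
    by (simp add: fps_deriv_funpow_sum fps_deriv_poly_times_exp del: fps_exp_0)
  \<comment> \<open>Multiplying back by e^(b x) restores the exponents c, as the induction
    hypothesis requires.\<close>
  then have "(\<Sum>c\<in>A. fps_of_poly ((twisted_pderiv (c - b) ^^ n) (P c)) * fps_exp (c - b)) * fps_exp b = 0"
    by simp
  then have "(\<Sum>c\<in>A. fps_of_poly ((twisted_pderiv (c - b) ^^ n) (P c)) * fps_exp c) = 0"
    by (simp only: sum_distrib_right mult.assoc exp[symmetric])
  from insert.IH[OF this] have z: "\<forall>c\<in>A. (twisted_pderiv (c - b) ^^ n) (P c) = 0" .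
  have A: "P c = 0" if "c \<in> A" for c
    by (rule twisted_pderiv_funpow_eq_0[of "c - b" n]) (use that z insert.hyps in auto)
  then have "fps_of_poly (P b) * fps_exp b = 0" using insert.prems insert.hyps by simp
  then show ?case using A by simp
qed simp

section \<open>Simple E-functions\<close>

lemma fps_to_fls_X_power: "fps_to_fls (fps_X ^ w :: complex fps) = fls_X_intpow (int w)"
  by (simp add: fps_to_fls_power fls_X_power_conv_shift_1)

text \<open>Moving the power of x to the other side removes Laurent series from all later arguments
  about simple functions.\<close>

lemma fls_X_intpow_mult_iff:
  "fps_to_fls g = fls_X_intpow (- int w) * fps_to_fls f \<longleftrightarrow> fps_X ^ w * g = (f :: complex fps)"
proof -
  have inv: "fls_X_intpow (int w) * (fls_X_intpow (- int w) :: complex fls) = 1"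
    using fls_X_intpow_times_fls_X_intpow[of "int w" "- int w", where 'a = complex] by simp
  have X: "fps_to_fls (fps_X ^ w * g) = fls_X_intpow (int w) * fps_to_fls g"
    unfolding fls_times_fps_to_fls fps_to_fls_X_power ..
  have "fps_X ^ w * g = f \<longleftrightarrow> fls_X_intpow (int w) * fps_to_fls g = fps_to_fls f"
    unfolding X[symmetric] by (rule fps_to_fls_eq_iff[symmetric])
  also have "\<dots> \<longleftrightarrow> fps_to_fls g = fls_X_intpow (- int w) * fps_to_fls f"
  proof -
    have "a * x = y \<longleftrightarrow> x = b * y" if "a * b = 1" for a b x y :: "complex fls"
    proof
      assume "a * x = y"
      then have "b * y = (a * b) * x" by (simp add: mult_ac)
      then show "x = b * y" using that by simp
    next
      assume "x = b * y"
      then have "a * x = (a * b) * y" by (simp add: mult_ac)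
      then show "a * x = y" using that by simp
    qed
    then show ?thesis using inv by blast
  qed
  finally show ?thesis by blast
qed

text \<open>The exponent \<omega> cannot be negative: otherwise g would be divisible by a positive
  power of x, against g(0) \<noteq> 0. Hence a natural number w can replace it.\<close>

lemma simple_E_withE:
  assumes "simple_E_with \<beta> g"
  obtains \<alpha> N l r w where "E_function g" "\<beta> \<in> Qbar" "\<beta> \<noteq> 0" "\<alpha> \<in> Qbar" "(2::nat) \<le> N"
    "\<forall>i\<in>{1..N}. l i \<in> Qbar" "\<forall>i\<in>{1..N}. l i \<noteq> 0" "inj_on r {1..N}"
    "fps_X ^ w * g = fps_exp \<alpha> * (\<Sum>i=1..N. fps_const (l i) * fps_exp (\<beta> * of_rat (r i)))" "fps_nth g 0 \<noteq> 0"
proof -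
  obtain \<omega> \<alpha> N l r where
    *: "E_function g" "\<beta> \<in> Qbar" "\<beta> \<noteq> 0" "\<alpha> \<in> Qbar" "(2::nat) \<le> N"
    "\<forall>i\<in>{1..N}. l i \<in> Qbar \<and> l i \<noteq> 0" "inj_on r {1..N}"
    and eq: "fps_to_fls g = fls_X_intpow (- \<omega>) *
          fps_to_fls (fps_exp \<alpha> * (\<Sum>i=1..N. fps_const (l i) * fps_exp (\<beta> * of_rat (r i))))"
    and nz: "fps_nth g 0 \<noteq> 0" using assms unfolding simple_E_with_def by blast
  let ?F = "fps_exp \<alpha> * (\<Sum>i=1..N. fps_const (l i) * fps_exp (\<beta> * of_rat (r i)))"
  have "0 \<le> \<omega>"
  proof (rule ccontr)
    assume neg: "\<not> 0 \<le> \<omega>"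
    define k where "k = nat (- \<omega>)"
    have "fps_to_fls g = fps_to_fls (fps_X ^ k * ?F)"
      using eq neg by (simp add: fls_times_fps_to_fls fps_to_fls_X_power k_def)
    then have "g = fps_X ^ k * ?F" by (simp only: fps_to_fls_eq_iff)
    then show False using nz neg by (simp add: k_def)
  qed
  then have "fps_X ^ nat \<omega> * g = ?F" using eq fls_X_intpow_mult_iff[of g "nat \<omega>" ?F] by simp
  then show ?thesis using * nz by (intro that[of \<alpha> N l r "nat \<omega>"]) auto
qed

lemma simple_E_withI:
  assumes "E_function g" "\<beta> \<in> Qbar" "\<beta> \<noteq> 0" "\<alpha> \<in> Qbar" "(2::nat) \<le> N"
    "\<forall>i\<in>{1..N}. l i \<in> Qbar" "\<forall>i\<in>{1..N}. l i \<noteq> 0" "inj_on r {1..N}"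
    "fps_X ^ w * g = fps_exp \<alpha> * (\<Sum>i=1..N. fps_const (l i) * fps_exp (\<beta> * of_rat (r i)))" "fps_nth g 0 \<noteq> 0"
  shows "simple_E_with \<beta> g"
  unfolding simple_E_with_def
  using assms fls_X_intpow_mult_iff[of g w]
  by (intro conjI exI[of _ "int w"] exI[of _ \<alpha>] exI[of _ N] exI[of _ l] exI[of _ r]) auto

text \<open>The frequencies \<alpha> + \<beta> r_i are collected as a set. Only their differences
  are recorded, as these do not involve \<alpha>; two distinct frequencies exist because N \<ge>
  2.\<close>

lemma simple_E_with_frequencies:
  assumes "simple_E_with \<beta> g"
  obtains A a b c w where "finite A" "\<forall>x\<in>A. a x \<noteq> 0" "b \<in> A" "c \<in> A" "b \<noteq> c"
    "\<forall>x\<in>A. \<forall>y\<in>A. x - y \<in> rat_line \<beta>"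
    "fps_X ^ w * g = (\<Sum>x\<in>A. fps_const (a x) * fps_exp x)"
proof -
  obtain \<alpha> N l r w where *: "E_function g" "\<beta> \<in> Qbar" "\<beta> \<noteq> 0" "\<alpha> \<in> Qbar" "(2::nat) \<le> N"
    "\<forall>i\<in>{1..N}. l i \<in> Qbar" "\<forall>i\<in>{1..N}. l i \<noteq> 0" "inj_on r {1..N}"
    "fps_X ^ w * g = fps_exp \<alpha> * (\<Sum>i=1..N. fps_const (l i) * fps_exp (\<beta> * of_rat (r i)))" "fps_nth g 0 \<noteq> 0"
    by (rule simple_E_withE[OF assms])
  define h where "h = (\<lambda>i. \<alpha> + \<beta> * of_rat (r i))"
  have inj: "inj_on h {1..N}"
  proof (rule inj_onI)
    fix i j assume ij: "i \<in> {1..N}" "j \<in> {1..N}" "h i = h j"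
    then have "r i = r j" using *(3) by (simp add: h_def)
    then show "i = j" using ij(1,2) by (rule inj_onD[OF *(8)])
  qed
  define a where "a = l \<circ> inv_into {1..N} h"
  have a: "a (h i) = l i" if "i \<in> {1..N}" for i using that inj by (simp add: a_def)
  show ?thesis
  proof (rule that[of "h ` {1..N}" a "h 1" "h 2" w])
    show "h 1 \<in> h ` {1..N}" "h 2 \<in> h ` {1..N}" using *(5) by (intro imageI; simp)+
    have "1 \<in> {1..N}" "2 \<in> {1..N}" using *(5) by auto
    then show "h 1 \<noteq> h 2" using inj_onD[OF inj, of 1 2] by auto
    show "\<forall>x\<in>h ` {1..N}. a x \<noteq> 0" using a *(7) by auto
    have "h i - h j = of_rat (r i - r j) * \<beta>" for i j by (simp add: h_def of_rat_diff algebra_simps)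
    then show "\<forall>x\<in>h ` {1..N}. \<forall>y\<in>h ` {1..N}. x - y \<in> rat_line \<beta>" unfolding rat_line_def by blast
    have "fps_X ^ w * g = (\<Sum>i=1..N. fps_const (l i) * fps_exp (h i))"
      unfolding *(9) h_def sum_distrib_left by (rule sum.cong) (simp_all add: fps_exp_add_mult mult_ac)
    also have "\<dots> = (\<Sum>i=1..N. fps_const (a (h i)) * fps_exp (h i))"
      by (rule sum.cong) (simp_all add: a)
    also have "\<dots> = (\<Sum>x\<in>h ` {1..N}. fps_const (a x) * fps_exp x)"
      by (simp only: sum.reindex[OF inj] comp_def)
    finally show "fps_X ^ w * g = (\<Sum>x\<in>h ` {1..N}. fps_const (a x) * fps_exp x)" .
  qed simp
qed

section \<open>The support of a simple E-function is well defined\<close>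

lemma rat_line_self: "x \<in> rat_line x"
  unfolding rat_line_def by (auto intro!: exI[of _ 1])

lemma rat_line_eqI:
  assumes "x \<in> rat_line \<beta>" "x \<in> rat_line \<gamma>" "x \<noteq> 0"
  shows "rat_line \<beta> = rat_line \<gamma>"
proof -
  have "rat_line \<beta> = rat_line x" if x: "x \<in> rat_line \<beta>" for \<beta>
  proof -
    obtain q where q: "x = of_rat q * \<beta>" using x unfolding rat_line_def by auto
    then have "q \<noteq> 0" using assms(3) by auto
    show ?thesis unfolding rat_line_def
    proof safe
      fix s
      show "\<exists>t. of_rat s * \<beta> = of_rat t * x \<and> True"
        using \<open>q \<noteq> 0\<close> by (intro exI[of _ "s / q"]) (simp add: q of_rat_divide)
      show "\<exists>t. of_rat s * x = of_rat t * \<beta> \<and> True"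
        by (intro exI[of _ "s * q"]) (simp add: q of_rat_mult)
    qed
  qed
  then show ?thesis using assms by metis
qed

text \<open>Independence of exponentials shows that the frequencies of one representation occur in
  the other, so a non-zero difference of frequencies lies on both lines, and a rational line is
  determined by any of its non-zero elements.\<close>

lemma simple_E_with_unique_line:
  assumes "simple_E_with \<beta> g" "simple_E_with \<gamma> g"
  shows "rat_line \<beta> = rat_line \<gamma>"
proof -
  obtain v A a b c where A: "finite A" "\<forall>x\<in>A. a x \<noteq> 0" "b \<in> A" "c \<in> A" "b \<noteq> c"
    "\<forall>x\<in>A. \<forall>y\<in>A. x - y \<in> rat_line \<beta>"
    "fps_X ^ v * g = (\<Sum>x\<in>A. fps_const (a x) * fps_exp x)"
    by (rule simple_E_with_frequencies[OF assms(1)])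
  obtain w B a' b' c' where B: "finite B" "\<forall>x\<in>B. a' x \<noteq> 0" "b' \<in> B" "c' \<in> B" "b' \<noteq> c'"
    "\<forall>x\<in>B. \<forall>y\<in>B. x - y \<in> rat_line \<gamma>"
    "fps_X ^ w * g = (\<Sum>x\<in>B. fps_const (a' x) * fps_exp x)"
    by (rule simple_E_with_frequencies[OF assms(2)])
  \<comment> \<open>The two powers v and w of x may differ, so each expansion is multiplied by the
    power of the other. The coefficients become monomials, which is why independence over the
    polynomials is invoked.\<close>
  define P where "P = (\<lambda>x. if x \<in> A then monom (a x) w else 0)"
  define Q where "Q = (\<lambda>x. if x \<in> B then monom (a' x) v else 0)"
  have P: "(\<Sum>x\<in>A \<union> B. fps_of_poly (P x) * fps_exp x) = fps_X ^ w * (fps_X ^ v * g)"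
  proof -
    have "fps_X ^ w * (fps_X ^ v * g) = (\<Sum>x\<in>A. fps_of_poly (P x) * fps_exp x)"
      unfolding A(7) sum_distrib_left
      by (rule sum.cong) (simp_all add: P_def fps_of_poly_monom algebra_simps)
    also have "\<dots> = (\<Sum>x\<in>A \<union> B. fps_of_poly (P x) * fps_exp x)"
      by (rule sum.mono_neutral_left) (use A(1) B(1) in \<open>auto simp: P_def\<close>)
    finally show ?thesis by simp
  qed
  have Q: "(\<Sum>x\<in>A \<union> B. fps_of_poly (Q x) * fps_exp x) = fps_X ^ v * (fps_X ^ w * g)"
  proof -
    have "fps_X ^ v * (fps_X ^ w * g) = (\<Sum>x\<in>B. fps_of_poly (Q x) * fps_exp x)"
      unfolding B(7) sum_distrib_left
      by (rule sum.cong) (simp_all add: Q_def fps_of_poly_monom algebra_simps)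
    also have "\<dots> = (\<Sum>x\<in>A \<union> B. fps_of_poly (Q x) * fps_exp x)"
      by (rule sum.mono_neutral_left) (use A(1) B(1) in \<open>auto simp: Q_def\<close>)
    finally show ?thesis by simp
  qed
  have "(\<Sum>x\<in>A \<union> B. fps_of_poly (P x - Q x) * fps_exp x) = 0"
    using P Q by (simp add: fps_of_poly_diff left_diff_distrib sum_subtractf mult.left_commute)
  then have "\<forall>x\<in>A \<union> B. P x - Q x = 0" using A(1) B(1) by (intro exp_poly_linear_independent) auto
  then have "x \<in> B" if "x \<in> A" for x using that A(2) by (auto simp: P_def Q_def split: if_splits)
  then have "b - c \<in> rat_line \<gamma>" using A(3,4) B(6) by blast
  then show ?thesis using A(3-6) by (intro rat_line_eqI[of "b - c"]) auto
qed

lemma E_support_eq: "simple_E_with \<beta> g \<Longrightarrow> E_support g = rat_line \<beta>"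
  unfolding E_support_def by (rule the_equality) (auto dest: simple_E_with_unique_line)

lemma simple_E_with_change_generator:
  assumes "simple_E_with \<beta> g" "rat_line \<beta> = rat_line \<gamma>"
  shows "simple_E_with \<gamma> g"
proof -
  obtain w \<alpha> N l r where *: "E_function g" "\<beta> \<in> Qbar" "\<beta> \<noteq> 0" "\<alpha> \<in> Qbar" "(2::nat) \<le> N"
    "\<forall>i\<in>{1..N}. l i \<in> Qbar" "\<forall>i\<in>{1..N}. l i \<noteq> 0" "inj_on r {1..N}"
    "fps_X ^ w * g = fps_exp \<alpha> * (\<Sum>i=1..N. fps_const (l i) * fps_exp (\<beta> * of_rat (r i)))" "fps_nth g 0 \<noteq> 0"
    by (rule simple_E_withE[OF assms(1)])
  have "\<beta> \<in> rat_line \<gamma>" using rat_line_self[of \<beta>] assms(2) by simp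
  then obtain q where q: "\<beta> = of_rat q * \<gamma>" unfolding rat_line_def by auto
  have q0: "q \<noteq> 0" using q *(3) by auto
  have g: "\<gamma> = of_rat (1 / q) * \<beta>" using q q0 by (simp add: of_rat_divide)
  have ag: "algebraic \<gamma>" unfolding g by (rule algebraic_times) (use *(2) in auto)
  have g0: "\<gamma> \<noteq> 0" using q *(3) by force
  show ?thesis
  proof (rule simple_E_withI[of g \<gamma> \<alpha> N l "\<lambda>i. q * r i" w])
    show "inj_on (\<lambda>i. q * r i) {1..N}"
    proof (rule inj_onI)
      fix i j assume ij: "i \<in> {1..N}" "j \<in> {1..N}" "q * r i = q * r j"
      then have "r i = r j" using q0 by simp
      then show "i = j" using ij(1,2) by (rule inj_onD[OF *(8)])
    qed
    show "fps_X ^ w * g = fps_exp \<alpha> * (\<Sum>i=1..N. fps_const (l i) * fps_exp (\<gamma> * of_rat (q * r i)))"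
      unfolding *(9) q by (simp add: of_rat_mult mult_ac)
  qed (use *(1,4-7,10) ag g0 in simp_all)
qed

section \<open>Polynomials in a single exponential\<close>

definition exp_poly :: "complex \<Rightarrow> complex poly \<Rightarrow> complex fps" where
  "exp_poly \<delta> P = poly (map_poly fps_const P) (fps_exp \<delta>)"

lemma exp_poly_0 [simp]: "exp_poly d 0 = 0"
  by (simp add: exp_poly_def)

lemma exp_poly_pCons: "exp_poly d (pCons a p) = fps_const a + fps_exp d * exp_poly d p"
  by (simp add: exp_poly_def Polynomial.map_poly_pCons)

lemma exp_poly_add: "exp_poly d (p + q) = exp_poly d p + exp_poly d q"
  by (induction p q rule: poly_induct2) (simp_all add: exp_poly_pCons algebra_simps flip: fps_const_add)

lemma exp_poly_smult: "exp_poly d (smult a p) = fps_const a * exp_poly d p"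
  by (induction p) (simp_all add: exp_poly_pCons algebra_simps flip: fps_const_mult)

text \<open>Substituting e^(\<delta> x) is a ring homomorphism; through it a Bezout relation between
  polynomials becomes one between E-functions.\<close>

lemma exp_poly_mult: "exp_poly d (p * q) = exp_poly d p * exp_poly d q"
  by (induction p) (simp_all add: exp_poly_pCons exp_poly_add exp_poly_smult algebra_simps)

lemma exp_poly_altdef:
  "exp_poly d p = (\<Sum>i\<le>degree p. fps_const (poly.coeff p i) * fps_exp (of_nat i * d))"
proof -
  have "degree (map_poly fps_const p) = degree p" by (rule degree_map_poly) auto
  then show ?thesis unfolding exp_poly_def poly_altdef
    by (simp add: coeff_map_poly fps_exp_power_mult)
qed

lemma exp_poly_monom: "exp_poly d (monom a n) = fps_const a * fps_exp (of_nat n * d)"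
proof (induction n)
  case (Suc n)
  then show ?case by (simp add: monom_Suc exp_poly_pCons fps_exp_add_mult algebra_simps)
qed (simp add: monom_0 exp_poly_pCons)

lemma exp_poly_sum: "exp_poly d (\<Sum>i\<in>I. f i) = (\<Sum>i\<in>I. exp_poly d (f i))"
  by (induction I rule: infinite_finite_induct) (simp_all add: exp_poly_add)

lemma E_function_sum: "(\<And>i. i \<in> I \<Longrightarrow> E_function (f i)) \<Longrightarrow> E_function (\<Sum>i\<in>I. f i)"
  by (induction I rule: infinite_finite_induct) (simp_all add: E_function_0 E_function_add)

lemma E_function_exp_poly:
  assumes "algebraic d" "p \<in> Qbar_poly" shows "E_function (exp_poly d p)"
  unfolding exp_poly_altdef using assms Qb.of_nat_mem
  by (intro E_function_sum E_function_mult E_function_const E_function_exp algebraic_times)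
     (auto simp: Qbar_poly_def)

text \<open>A non-zero constant term together with positive degree guarantees two distinct
  exponentials. The lowest frequency is carried by \<alpha>.\<close>

definition exp_poly_form :: "complex \<Rightarrow> complex fps \<Rightarrow> complex poly \<Rightarrow> bool" where
  "exp_poly_form \<delta> g P \<longleftrightarrow> P \<in> Qbar_poly \<and> poly.coeff P 0 \<noteq> 0 \<and> 1 \<le> degree P \<and>
     (\<exists>w \<alpha>. algebraic \<alpha> \<and> fps_X ^ w * g = fps_exp \<alpha> * exp_poly \<delta> P)"

lemma common_denominator:
  assumes "finite I"
  shows "\<exists>m>0. \<forall>i\<in>I. (r i :: rat) * of_nat m \<in> \<int>"
  using assms
proof (induction I rule: finite_induct)
  case (insert i I)
  then obtain m where m: "0 < m" "\<forall>i\<in>I. r i * of_nat m \<in> \<int>" by blast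
  obtain a b where ab: "r i = of_int a / of_int b" "0 < b"
    using quotient_of_div[of "r i"] quotient_of_denom_pos[of "r i"] by (metis prod.exhaust)
  have "r i * of_nat (m * nat b) = of_int (a * int m)" using ab by simp
  then have "r i * of_nat (m * nat b) \<in> \<int>" by (metis Ints_of_int)
  moreover have "r j * of_nat (m * nat b) \<in> \<int>" if "j \<in> I" for j
  proof -
    have "r j * of_nat (m * nat b) = (r j * of_nat m) * of_nat (nat b)" by simp
    then show ?thesis using m(2) that by (metis Ints_mult Ints_of_nat)
  qed
  ultimately show ?case using m(1) ab(2) by (intro exI[of _ "m * nat b"]) auto
qed (auto intro: exI[of _ 1])

text \<open>Any multiple m k of a common denominator m of the r_i works as well. This freedom lets
  two functions on the same line share one \<delta>, by using the product of their
  denominators.\<close>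

lemma simple_E_with_imp_exp_poly_form:
  assumes "simple_E_with \<beta> g"
  obtains m where "0 < m" "\<And>k. 0 < k \<Longrightarrow> \<exists>P. exp_poly_form (\<beta> / of_nat (m * k)) g P"
proof -
  obtain w \<alpha> N l r where *: "E_function g" "\<beta> \<in> Qbar" "\<beta> \<noteq> 0" "\<alpha> \<in> Qbar" "(2::nat) \<le> N"
    "\<forall>i\<in>{1..N}. l i \<in> Qbar" "\<forall>i\<in>{1..N}. l i \<noteq> 0" "inj_on r {1..N}"
    "fps_X ^ w * g = fps_exp \<alpha> * (\<Sum>i=1..N. fps_const (l i) * fps_exp (\<beta> * of_rat (r i)))" "fps_nth g 0 \<noteq> 0"
    by (rule simple_E_withE[OF assms(1)])
  obtain m where m: "0 < m" "\<forall>i\<in>{1..N}. r i * of_nat m \<in> \<int>" using common_denominator[of "{1..N}" r] by auto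
  show ?thesis
  proof (rule that[OF m(1)])
    fix k :: nat assume k: "0 < k"
    define n where "n = m * k"
    have n: "0 < n" using m(1) k by (simp add: n_def)
    have "\<exists>a. r i = of_int a / of_nat n" if i: "i \<in> {1..N}" for i
    proof -
      obtain a where "r i * of_nat m = of_int a" using m(2) i by (meson Ints_cases)
      then have "r i = of_int (a * int k) / of_nat n" using m(1) k by (simp add: n_def field_simps)
      then show ?thesis by blast
    qed
    then obtain s where s: "\<And>i. i \<in> {1..N} \<Longrightarrow> r i = of_int (s i) / of_nat n" by metis
    have inj: "inj_on s {1..N}"
    proof (rule inj_onI)
      fix i j assume ij: "i \<in> {1..N}" "j \<in> {1..N}" "s i = s j"
      then have "r i = r j" using s by simp
      then show "i = j" using ij *(8) by (auto dest: inj_onD)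
    qed
    \<comment> \<open>Factoring out the lowest exponential turns all exponents into natural numbers,
      with 0 among them.\<close>
    define b where "b = Min (s ` {1..N})"
    have b: "b \<le> s i" if "i \<in> {1..N}" for i using that by (simp add: b_def)
    have "b \<in> s ` {1..N}" unfolding b_def by (rule Min_in) (use *(5) in auto)
    then obtain i0 where i0: "i0 \<in> {1..N}" "s i0 = b" by auto
    \<comment> \<open>Any index other than i0 has a strictly larger exponent, and this makes the
      degree of P positive.\<close>
    define i1 where "i1 = (if i0 = 1 then 2 else 1 :: nat)"
    have i1: "i1 \<in> {1..N}" "i1 \<noteq> i0" using *(5) by (auto simp: i1_def)
    have s1: "b < s i1" using b[OF i1(1)] inj_onD[OF inj, of i1 i0] i0 i1 by fastforce
    define e where "e = (\<lambda>i. nat (s i - b))"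
    have inj_e: "inj_on e {1..N}"
    proof (rule inj_onI)
      fix i j assume ij: "i \<in> {1..N}" "j \<in> {1..N}" "e i = e j"
      then have "s i = s j" using b[of i] b[of j] by (simp add: e_def)
      then show "i = j" using ij inj by (auto dest: inj_onD)
    qed
    define P where "P = (\<Sum>i\<in>{1..N}. monom (l i) (e i))"
    have cP: "poly.coeff P (e i) = l i" if i: "i \<in> {1..N}" for i
    proof -
      have "poly.coeff P (e i) = (\<Sum>j\<in>{1..N}. if i = j then l j else 0)"
        unfolding P_def coeff_sum using inj_e i by (intro sum.cong) (auto dest: inj_onD)
      then show ?thesis using i by (simp add: sum.delta')
    qed
    define \<delta> where "\<delta> = \<beta> / of_nat n"
    have exps: "\<alpha> + \<beta> * of_rat (r i) = (\<alpha> + of_int b * \<delta>) + of_nat (e i) * \<delta>" if i: "i \<in> {1..N}" for i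
    proof -
      have eq: "(of_int (s i) :: complex) = of_int b + of_nat (e i)"
        using b[OF i] by (simp add: e_def of_nat_nat)
      have "(of_rat (r i) :: complex) = (of_int b + of_nat (e i)) / of_nat n"
        unfolding eq[symmetric] by (simp add: s[OF i] of_rat_divide)
      then show ?thesis using n by (simp add: \<delta>_def field_simps)
    qed
    have "fps_X ^ w * g = (\<Sum>i=1..N. fps_const (l i) * fps_exp (\<alpha> + \<beta> * of_rat (r i)))"
      unfolding *(9) sum_distrib_left by (rule sum.cong) (simp_all add: fps_exp_add_mult algebra_simps)
    also have "\<dots> = (\<Sum>i=1..N. fps_const (l i) * fps_exp ((\<alpha> + of_int b * \<delta>) + of_nat (e i) * \<delta>))"
      by (rule sum.cong) (simp_all only: exps)
    also have "\<dots> = fps_exp (\<alpha> + of_int b * \<delta>) * exp_poly \<delta> P"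
      unfolding P_def exp_poly_sum exp_poly_monom sum_distrib_left
      by (rule sum.cong) (simp_all only: fps_exp_add_mult mult_ac)
    finally have eq: "fps_X ^ w * g = fps_exp (\<alpha> + of_int b * \<delta>) * exp_poly \<delta> P" .
    have "\<delta> = of_rat (1 / of_nat n) * \<beta>" by (simp add: \<delta>_def of_rat_divide)
    then have "algebraic \<delta>" using *(2) algebraic_times by simp
    then have "algebraic (of_rat (of_int b) * \<delta>)" by (intro algebraic_times) auto
    then have alg: "algebraic (\<alpha> + of_int b * \<delta>)" using *(4) by (auto intro: algebraic_plus)
    have "P \<in> Qbar_poly" unfolding P_def using *(6) by (auto intro!: Qp.sum_mem Qbar_poly_monom)
    moreover have "poly.coeff P 0 \<noteq> 0" using cP[OF i0(1)] i0 *(7) by (simp add: e_def)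
    moreover have "1 \<le> degree P"
    proof -
      have "e i1 \<le> degree P" by (rule le_degree) (use cP[OF i1(1)] *(7) i1 in auto)
      then show ?thesis using s1 by (simp add: e_def)
    qed
    ultimately have "exp_poly_form \<delta> g P" unfolding exp_poly_form_def using alg eq by blast
    then show "\<exists>P. exp_poly_form (\<beta> / of_nat (m * k)) g P" unfolding \<delta>_def n_def by blast
  qed
qed

lemma exp_poly_form_imp_simple:
  assumes "exp_poly_form \<delta> g P" "E_function g" "fps_nth g 0 \<noteq> 0" "algebraic \<delta>" "\<delta> \<noteq> 0"
  shows "simple_E_with \<delta> g"
proof -
  obtain w \<alpha> where P: "P \<in> Qbar_poly" "poly.coeff P 0 \<noteq> 0" "1 \<le> degree P" "algebraic \<alpha>"
    "fps_X ^ w * g = fps_exp \<alpha> * exp_poly \<delta> P" using assms(1) unfolding exp_poly_form_def by auto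
  define S where "S = {i. poly.coeff P i \<noteq> 0}"
  have S: "S \<subseteq> {..degree P}" by (auto simp: S_def le_degree)
  then have fin: "finite S" by (rule finite_subset) simp
  obtain h where h: "bij_betw h {1..card S} S" using ex_bij_betw_nat_finite_1[OF fin] by blast
  \<comment> \<open>The constant and the leading term are different since the degree is positive;
    they supply the two exponentials required.\<close>
  have "{0, degree P} \<subseteq> S" using P by (auto simp: S_def)
  from card_mono[OF fin this] have card: "2 \<le> card S" using P(3) by simp
  have "exp_poly \<delta> P = (\<Sum>i\<in>S. fps_const (poly.coeff P i) * fps_exp (of_nat i * \<delta>))"
    unfolding exp_poly_altdef by (rule sum.mono_neutral_right) (use S in \<open>auto simp: S_def\<close>)
  also have "\<dots> = (\<Sum>i=1..card S. fps_const (poly.coeff P (h i)) * fps_exp (of_nat (h i) * \<delta>))"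
    by (rule sum.reindex_bij_betw[OF h, symmetric])
  finally have eq: "exp_poly \<delta> P = (\<Sum>i=1..card S. fps_const (poly.coeff P (h i)) * fps_exp (\<delta> * of_rat (of_nat (h i))))"
    by (simp add: mult.commute)
  show ?thesis
  proof (rule simple_E_withI[where N = "card S" and r = "\<lambda>i. of_nat (h i)" and l = "\<lambda>i. poly.coeff P (h i)"])
    show "inj_on (\<lambda>i. of_nat (h i) :: rat) {1..card S}"
      by (rule inj_onI) (use h in \<open>auto simp: bij_betw_def dest: inj_onD\<close>)
    show "fps_X ^ w * g = fps_exp \<alpha> * (\<Sum>i=1..card S. fps_const (poly.coeff P (h i)) * fps_exp (\<delta> * of_rat (of_nat (h i))))"
      using P(5) eq by simp
    show "\<forall>i\<in>{1..card S}. poly.coeff P (h i) \<noteq> 0"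
      using bij_betwE[OF h] by (auto simp: S_def)
  qed (use assms P card in \<open>auto simp: Qbar_poly_def\<close>)
qed

lemma simple_E_with_common_form:
  assumes "simple_E_with \<beta> f" "simple_E_with \<beta> g"
  obtains \<delta> P Q where "algebraic \<delta>" "\<delta> \<noteq> 0" "rat_line \<delta> = rat_line \<beta>" "exp_poly_form \<delta> f P" "exp_poly_form \<delta> g Q"
proof -
  obtain m where m: "0 < m" "\<And>k. 0 < k \<Longrightarrow> \<exists>P. exp_poly_form (\<beta> / of_nat (m * k)) f P"
    by (rule simple_E_with_imp_exp_poly_form[OF assms(1)]) blast
  obtain n where n: "0 < n" "\<And>k. 0 < k \<Longrightarrow> \<exists>P. exp_poly_form (\<beta> / of_nat (n * k)) g P"
    by (rule simple_E_with_imp_exp_poly_form[OF assms(2)]) blast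
  define \<delta> where "\<delta> = \<beta> / of_nat (m * n)"
  have b: "algebraic \<beta>" "\<beta> \<noteq> 0" using assms(1) unfolding simple_E_with_def by auto
  have d: "\<delta> = of_rat (1 / of_nat (m * n)) * \<beta>" by (simp add: \<delta>_def of_rat_divide del: of_nat_mult)
  have nz: "\<delta> \<noteq> 0" using b m n by (simp add: \<delta>_def)
  have "\<delta> \<in> rat_line \<beta>" unfolding rat_line_def using d by blast
  then have line: "rat_line \<delta> = rat_line \<beta>" using rat_line_eqI[OF rat_line_self] nz by blast
  obtain P where P: "exp_poly_form \<delta> f P" using m(2)[OF n(1)] unfolding \<delta>_def by blast
  obtain Q where Q: "exp_poly_form \<delta> g Q" using n(2)[OF m(1)] unfolding \<delta>_def by (auto simp: mult.commute)
  show ?thesis by (rule that[OF _ nz line P Q]) (unfold d, rule algebraic_times, use b in auto)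
qed

text \<open>In a common variable e^(\<delta> x) the product corresponds to P Q, which again has
  non-zero constant term and positive degree; so cancellation cannot leave a single
  exponential.\<close>

lemma simple_E_with_mult:
  assumes "simple_E_with \<beta> f" "simple_E_with \<beta> g"
  shows "simple_E_with \<beta> (f * g)"
proof -
  obtain \<delta> P Q where d: "algebraic \<delta>" "\<delta> \<noteq> 0" "rat_line \<delta> = rat_line \<beta>"
    "exp_poly_form \<delta> f P" "exp_poly_form \<delta> g Q" by (rule simple_E_with_common_form[OF assms])
  obtain v \<alpha> where P: "P \<in> Qbar_poly" "poly.coeff P 0 \<noteq> 0" "1 \<le> degree P" "algebraic \<alpha>"
    "fps_X ^ v * f = fps_exp \<alpha> * exp_poly \<delta> P" using d(4) unfolding exp_poly_form_def by auto
  obtain w \<gamma> where Q: "Q \<in> Qbar_poly" "poly.coeff Q 0 \<noteq> 0" "1 \<le> degree Q" "algebraic \<gamma>"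
    "fps_X ^ w * g = fps_exp \<gamma> * exp_poly \<delta> Q" using d(5) unfolding exp_poly_form_def by auto
  have "P \<noteq> 0" "Q \<noteq> 0" using P Q by auto
  have "fps_X ^ (v + w) * (f * g) = (fps_X ^ v * f) * (fps_X ^ w * g)" by (simp add: power_add mult_ac)
  also have "\<dots> = fps_exp (\<alpha> + \<gamma>) * exp_poly \<delta> (P * Q)"
    unfolding P(5) Q(5) by (simp add: exp_poly_mult fps_exp_add_mult mult_ac)
  finally have "exp_poly_form \<delta> (f * g) (P * Q)"
    unfolding exp_poly_form_def using P Q \<open>P \<noteq> 0\<close> \<open>Q \<noteq> 0\<close>
    by (auto simp: degree_mult_eq coeff_mult_0 intro!: Qp.mult_mem algebraic_plus)
  then have "simple_E_with \<delta> (f * g)"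
    using assms d unfolding simple_E_with_def[of \<beta>]
    by (intro exp_poly_form_imp_simple) (auto intro: E_function_mult)
  then show ?thesis using simple_E_with_change_generator d(3) by blast
qed

section \<open>Greatest common divisors of simple E-functions\<close>

text \<open>Euclid's algorithm inside the complex polynomials, arranged so that the gcd, the Bezout
  coefficients and the cofactors all keep algebraic coefficients.\<close>

lemma Qbar_poly_bezout:
  assumes "P \<in> Qbar_poly" "Q \<in> Qbar_poly"
  shows "\<exists>D U V A B. D \<in> Qbar_poly \<and> U \<in> Qbar_poly \<and> V \<in> Qbar_poly \<and> A \<in> Qbar_poly \<and> B \<in> Qbar_poly \<and>
    D = U * P + V * Q \<and> P = D * A \<and> Q = D * B"
proof -
  \<comment> \<open>The zero polynomial must rank below the non-zero constants, so that a division
    step ending in 0 also decreases the measure.\<close>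
  define sz where "sz = (\<lambda>p :: complex poly. if p = 0 then 0 else Suc (degree p))"
  let ?B = "\<lambda>P Q. \<exists>D U V A B. D \<in> Qbar_poly \<and> U \<in> Qbar_poly \<and> V \<in> Qbar_poly \<and> A \<in> Qbar_poly \<and> B \<in> Qbar_poly \<and>
    D = U * P + V * Q \<and> P = D * A \<and> Q = D * B"
  have sym: "?B Q P" if B: "?B P Q" for P Q
  proof -
    from B obtain D U V A B where D: "D \<in> Qbar_poly" "U \<in> Qbar_poly" "V \<in> Qbar_poly" "A \<in> Qbar_poly" "B \<in> Qbar_poly"
      "D = U * P + V * Q" "P = D * A" "Q = D * B" by blast
    have e: "D = V * Q + U * P" using D(6) by (simp only: add.commute)
    show ?thesis
      by (rule exI[of _ D], rule exI[of _ V], rule exI[of _ U], rule exI[of _ B],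
          rule exI[of _ A]) (intro conjI D e)
  qed
  have zero: "?B 0 Q" if "Q \<in> Qbar_poly" for Q
    by (rule exI[of _ Q], rule exI[of _ 0], rule exI[of _ 1], rule exI[of _ 0],
        rule exI[of _ 1]) (use that Qp.zero_mem Qp.one_mem in auto)
  have step: "?B P Q" if PQ: "P \<in> Qbar_poly" "Q \<in> Qbar_poly" "P \<noteq> 0" "Q \<noteq> 0" "degree Q \<le> degree P"
    and IH: "\<And>P'. P' \<in> Qbar_poly \<Longrightarrow> sz P' < sz P \<Longrightarrow> ?B P' Q" for P Q
  proof -
    \<comment> \<open>M Q has the leading term of P, so subtracting it lowers the degree or gives
      0.\<close>
    define M where "M = monom (lead_coeff P / lead_coeff Q) (degree P - degree Q)"
    define P' where "P' = P - M * Q"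
    have "algebraic (lead_coeff P * inverse (lead_coeff Q))"
      using PQ(1,2) by (intro algebraic_times algebraic_inverse) (auto simp: Qbar_poly_def)
    then have M: "M \<in> Qbar_poly" unfolding M_def by (intro Qbar_poly_monom) (simp add: divide_inverse)
    then have P': "P' \<in> Qbar_poly" unfolding P'_def using PQ by (intro Qp.diff_mem Qp.mult_mem)
    have M0: "M \<noteq> 0" using PQ by (simp add: M_def)
    have dM: "degree M = degree P - degree Q" using PQ by (simp add: M_def degree_monom_eq)
    have dMQ: "degree (M * Q) = degree P" using M0 PQ dM by (simp add: degree_mult_eq)
    have "lead_coeff (M * Q) = lead_coeff P"
      unfolding lead_coeff_mult using PQ dM by (simp add: M_def)
    then have "poly.coeff P' (degree P) = 0" using dMQ by (simp add: P'_def)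
    moreover have "degree P' \<le> degree P" unfolding P'_def by (rule degree_diff_le) (use dMQ in auto)
    ultimately have "P' = 0 \<or> degree P' < degree P" by (intro eq_zero_or_degree_less)
    then have "sz P' < sz P" using PQ(3) by (auto simp: sz_def)
    from IH[OF P' this] obtain D U V A B where D: "D \<in> Qbar_poly" "U \<in> Qbar_poly" "V \<in> Qbar_poly"
      "A \<in> Qbar_poly" "B \<in> Qbar_poly" "D = U * P' + V * Q" "P' = D * A" "Q = D * B" by blast
    have e1: "P = D * (A + M * B)"
      using D(7,8) unfolding P'_def by (metis diff_eq_eq distrib_left mult.left_commute)
    have e2: "D = U * P + (V - U * M) * Q"
      using D(6) unfolding P'_def by (simp add: algebra_simps)
    show ?thesis
      by (rule exI[of _ D], rule exI[of _ U], rule exI[of _ "V - U * M"],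
          rule exI[of _ "A + M * B"], rule exI[of _ B])
         (intro conjI D(1-5) D(8) M e1 e2 Qp.diff_mem Qp.mult_mem Qp.add_mem)
  qed
  show ?thesis using assms
  proof (induction "sz P + sz Q" arbitrary: P Q rule: less_induct)
    case less
    consider "P = 0" | "Q = 0" | "P \<noteq> 0" "Q \<noteq> 0" "degree Q \<le> degree P" | "P \<noteq> 0" "Q \<noteq> 0" "degree P \<le> degree Q"
      by linarith
    then show ?case
    proof cases
      case 1
      then show ?thesis using zero less.prems by simp
    next
      case 2
      then show ?thesis using sym[OF zero] less.prems by simp
    next
      case 3
      show ?thesis
        by (rule step) (use 3 less.prems less.hyps in auto)
    next
      case 4
      have "?B Q P"
        by (rule step) (use 4 less.prems sym[OF less.hyps] in auto)
      then show ?thesis by (rule sym)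
    qed
  qed
qed

lemma E_divides_iff: "a divides\<^bsub>E_ring\<^esub> b \<longleftrightarrow> (\<exists>h. E_function h \<and> b = a * h)"
  by (auto simp: factor_def)

text \<open>As b is invertible as a power series, c = x^n (a / b); since c is an E-function, so is a
  / b after the power of x is divided out.\<close>

lemma X_power_cofactor:
  assumes "fps_nth b 0 \<noteq> 0" "fps_X ^ n * a = b * c" "E_function c"
  shows "b divides\<^bsub>E_ring\<^esub> a"
proof -
  have inv: "inverse b * b = 1" using assms(1) by (rule inverse_mult_eq_1)
  then have c: "fps_X ^ n * (inverse b * a) = c"
    using assms(2) by (metis mult.assoc mult.left_commute mult.left_neutral)
  have "E_function (inverse b * a)" by (rule E_function_X_power_mult_cancel[of n]) (simp add: c assms(3))
  moreover have "a = b * (inverse b * a)" using inv by (metis mult.assoc mult.commute mult.left_neutral)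
  ultimately show ?thesis unfolding E_divides_iff by blast
qed

lemma E_function_X_power: "E_function (fps_X ^ n)"
proof (induction n)
  case (Suc n)
  have coeff: "egf_coeff fps_X k = (if k = 1 then 1 else 0)" for k by (simp add: egf_coeff_def)
  have "E_function fps_X"
  proof (rule E_functionI[where A = 1 and B = 1 and d = "\<lambda>_. 1"])
    show "norm (\<sigma> (egf_coeff fps_X k)) \<le> 1 ^ (k + 1)" if "galois_aut \<sigma>" for \<sigma> k
      using that by (simp add: coeff galois_aut_0 galois_aut_1)
    show "D_finite fps_X"
    proof (rule D_module_imp_D_finite)
      show "D_module 1 {1}" unfolding D_module_def by (auto simp: Qf.one_mem Qf.rspan_0)
      have "fps_X * 1 \<in> Qf.rspan {1}" by (intro Qf.rspan_scale Qbar_pfps_X Qf.rspan_base) auto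
      then show "fps_X \<in> Qf.rspan {1}" by simp
    qed
  qed (auto simp: coeff)
  then show ?case using Suc by (auto intro: E_function_mult)
qed (simp add: E_function_1)

lemma simple_E_with_gcd:
  assumes "simple_E_with \<beta> f" "simple_E_with \<beta> g"
  shows "\<exists>d\<in>carrier E_ring. d gcdof\<^bsub>E_ring\<^esub> f g"
proof -
  obtain \<delta> P Q where d: "algebraic \<delta>" "\<delta> \<noteq> 0" "rat_line \<delta> = rat_line \<beta>"
    "exp_poly_form \<delta> f P" "exp_poly_form \<delta> g Q" by (rule simple_E_with_common_form[OF assms])
  obtain v \<alpha> where P: "P \<in> Qbar_poly" "algebraic \<alpha>"
    "fps_X ^ v * f = fps_exp \<alpha> * exp_poly \<delta> P" using d(4) unfolding exp_poly_form_def by auto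
  obtain w \<gamma> where Q: "Q \<in> Qbar_poly" "algebraic \<gamma>"
    "fps_X ^ w * g = fps_exp \<gamma> * exp_poly \<delta> Q" using d(5) unfolding exp_poly_form_def by auto
  obtain D U V A B where D: "D \<in> Qbar_poly" "U \<in> Qbar_poly" "V \<in> Qbar_poly" "A \<in> Qbar_poly" "B \<in> Qbar_poly"
    "D = U * P + V * Q" "P = D * A" "Q = D * B" using Qbar_poly_bezout[OF P(1) Q(1)] by blast
  have nz: "fps_nth f 0 \<noteq> 0" using assms(1) unfolding simple_E_with_def by auto
  have E: "E_function (exp_poly \<delta> p)" if "p \<in> Qbar_poly" for p by (rule E_function_exp_poly[OF d(1) that])
  \<comment> \<open>D(e^(\<delta> x)) vanishes at 0 when D(1) = 0, but f does not; so this zero is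
    removed before the gcd is formed.\<close>
  define n where "n = subdegree (exp_poly \<delta> D)"
  define h where "h = fps_shift n (exp_poly \<delta> D)"
  have h: "exp_poly \<delta> D = fps_X ^ n * h"
    unfolding h_def n_def using subdegree_decompose[of "exp_poly \<delta> D"] by (simp add: mult.commute)
  have "exp_poly \<delta> D \<noteq> 0"
  proof
    assume "exp_poly \<delta> D = 0"
    then have "fps_X ^ v * f = 0" using P(3) D(7) by (simp add: exp_poly_mult)
    then show False using nz by auto
  qed
  then have h0: "fps_nth h 0 \<noteq> 0" unfolding h_def n_def by (simp add: nth_subdegree_nonzero)
  have Eh: "E_function h" by (rule E_function_X_power_mult_cancel[of n]) (use E[OF D(1)] h in simp)
  have "fps_X ^ v * f = h * (fps_X ^ n * (fps_exp \<alpha> * exp_poly \<delta> A))"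
    unfolding P(3) D(7) exp_poly_mult h by (simp add: mult_ac)
  then have hf: "h divides\<^bsub>E_ring\<^esub> f"
    by (rule X_power_cofactor[OF h0]) (intro E_function_mult E_function_X_power E D E_function_exp P(2))
  have "fps_X ^ w * g = h * (fps_X ^ n * (fps_exp \<gamma> * exp_poly \<delta> B))"
    unfolding Q(3) D(8) exp_poly_mult h by (simp add: mult_ac)
  then have hg: "h divides\<^bsub>E_ring\<^esub> g"
    by (rule X_power_cofactor[OF h0]) (intro E_function_mult E_function_X_power E D E_function_exp Q(2))
  have "c divides\<^bsub>E_ring\<^esub> h" if c: "c divides\<^bsub>E_ring\<^esub> f" "c divides\<^bsub>E_ring\<^esub> g" for c
  proof -
    obtain a b where a: "E_function a" "f = c * a" and b: "E_function b" "g = c * b"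
      using c unfolding E_divides_iff by blast
    \<comment> \<open>This value allows \<open>X_power_cofactor\<close> to be applied with c as the
      divisor.\<close>
    have c0: "fps_nth c 0 \<noteq> 0" using nz a(2) by auto
    have eP: "exp_poly \<delta> P = fps_exp (- \<alpha>) * (fps_X ^ v * f)"
      unfolding P(3) by (simp add: mult.assoc[symmetric] fps_exp_add_mult[symmetric])
    have eQ: "exp_poly \<delta> Q = fps_exp (- \<gamma>) * (fps_X ^ w * g)"
      unfolding Q(3) by (simp add: mult.assoc[symmetric] fps_exp_add_mult[symmetric])
    have "fps_X ^ n * h = exp_poly \<delta> U * exp_poly \<delta> P + exp_poly \<delta> V * exp_poly \<delta> Q"
      unfolding h[symmetric] by (subst D(6)) (simp add: exp_poly_add exp_poly_mult)
    also have "\<dots> = c * (exp_poly \<delta> U * (fps_exp (- \<alpha>) * (fps_X ^ v * a))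
        + exp_poly \<delta> V * (fps_exp (- \<gamma>) * (fps_X ^ w * b)))"
      unfolding eP eQ a(2) b(2) by (simp add: algebra_simps)
    finally show ?thesis
      by (rule X_power_cofactor[OF c0])
         (intro E_function_add E_function_mult E E_function_X_power D E_function_exp algebraic_minus P(2) Q(2) a b)
  qed
  then show ?thesis using hf hg Eh by (auto simp: isgcd_def)
qed

section \<open>The factorization conjecture and divisibility\<close>

lemma E_divides_mult:
  assumes "a divides\<^bsub>E_ring\<^esub> b" "c divides\<^bsub>E_ring\<^esub> d"
  shows "a * c divides\<^bsub>E_ring\<^esub> b * d"
proof -
  obtain h k where "E_function h" "b = a * h" "E_function k" "d = c * k"
    using assms unfolding E_divides_iff by blast
  then have "E_function (h * k)" "b * d = (a * c) * (h * k)" by (simp_all add: E_function_mult mult_ac)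
  then show ?thesis unfolding E_divides_iff by blast
qed

lemma E_divides_prod:
  assumes "\<And>i. i \<in> I \<Longrightarrow> f i divides\<^bsub>E_ring\<^esub> g i"
  shows "(\<Prod>i\<in>I. f i) divides\<^bsub>E_ring\<^esub> (\<Prod>i\<in>I. g i)"
proof -
  have "1 divides\<^bsub>E_ring\<^esub> 1" unfolding E_divides_iff using E_function_1 by auto
  then show ?thesis using assms
    by (induction I rule: infinite_finite_induct) (auto intro: E_divides_mult)
qed

lemma E_function_prod: "(\<And>i. i \<in> I \<Longrightarrow> E_function (f i)) \<Longrightarrow> E_function (\<Prod>i\<in>I. f i)"
  by (induction I rule: infinite_finite_induct) (auto intro: E_function_mult E_function_1)

lemma E_function_prod_mset: "(\<And>h. h \<in># M \<Longrightarrow> E_function h) \<Longrightarrow> E_function (prod_mset M)"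
  by (induction M) (auto intro: E_function_mult E_function_1)

lemma E_divides_prod_mset:
  assumes "M \<subseteq># N" "\<And>h. h \<in># N \<Longrightarrow> E_function h"
  shows "prod_mset M divides\<^bsub>E_ring\<^esub> prod_mset N"
proof -
  have "prod_mset N = prod_mset M * prod_mset (N - M)"
    using assms(1) by (metis prod_mset_Un subset_mset.add_diff_inverse)
  moreover have "E_function (prod_mset (N - M))"
    by (rule E_function_prod_mset) (use assms(2) in \<open>auto dest: in_diffD\<close>)
  ultimately show ?thesis unfolding E_divides_iff by blast
qed

text \<open>The component of a factorization at the line V: the unique simple factor with that
  support, or 1 if there is none. Being a product, it is defined for every V and every list.\<close>

definition support_part :: "complex set \<Rightarrow> complex fps list \<Rightarrow> complex fps" where
  "support_part V ss = prod_list (filter (\<lambda>s. E_support s = V) ss)"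

lemma support_part_simps [simp]:
  "support_part V [] = 1"
  "support_part V (s # ss) = (if E_support s = V then s else 1) * support_part V ss"
  by (simp_all add: support_part_def)

lemma E_function_support_part: "\<forall>s\<in>set ss. E_function s \<Longrightarrow> E_function (support_part V ss)"
  by (induction ss) (auto intro: E_function_mult E_function_1)

lemma support_part_eq_1: "V \<notin> E_support ` set ss \<Longrightarrow> support_part V ss = 1"
  by (induction ss) auto

lemma support_part_eq:
  assumes "distinct (map E_support ss)" "s \<in> set ss"
  shows "support_part (E_support s) ss = s"
  using assms
proof (induction ss)
  case (Cons t ss)
  show ?case
  proof (cases "s = t")
    case True
    then have "E_support s \<notin> E_support ` set ss" using Cons.prems(1) by simp
    then show ?thesis using True by (simp add: support_part_eq_1)
  next
    case False
    then have "s \<in> set ss" "E_support t \<noteq> E_support s" using Cons.prems by auto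
    then show ?thesis using Cons by simp
  qed
qed simp

lemma prod_list_support_part:
  assumes "finite T" "E_support ` set ss \<subseteq> T"
  shows "prod_list ss = (\<Prod>V\<in>T. support_part V ss)"
  using assms(2)
proof (induction ss)
  case (Cons s ss)
  have "(\<Prod>V\<in>T. if E_support s = V then s else 1) = s"
    using Cons.prems assms(1) by (simp add: prod.delta')
  then show ?case using Cons by (simp add: prod.distrib)
qed simp

text \<open>Uniqueness determines the simple factors only as a multiset, and components do not see
  the order.\<close>

lemma support_part_mset_cong:
  assumes "mset ss = mset ts" shows "support_part V ss = support_part V ts"
proof -
  have "support_part V ss = prod_mset (filter_mset (\<lambda>s. E_support s = V) (mset ss))" for ss
    by (simp only: support_part_def mset_filter[symmetric] prod_mset_prod_list)
  then show ?thesis using assms by simp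
qed

text \<open>Simple functions do not vanish at \<open>0\<close>, so the exponent \<open>p\<close> in their normalization is \<open>0\<close>.\<close>
lemma normalized_simple_iff:
  assumes "simple_E_with \<beta> f"
  shows "normalized_E f \<longleftrightarrow> fps_nth f 0 = 1 \<and> fps_nth f 1 = 0"
proof
  assume "normalized_E f"
  then obtain p where p: "\<forall>i<p. fps_nth f i = 0" "fps_nth f p = 1" "fps_nth f (p + 1) = 0"
    unfolding normalized_E_def by blast
  have "fps_nth f 0 \<noteq> 0" using assms unfolding simple_E_with_def by blast
  then have "p = 0" using p(1) by blast
  then show "fps_nth f 0 = 1 \<and> fps_nth f 1 = 0" using p by simp
next
  assume "fps_nth f 0 = 1 \<and> fps_nth f 1 = 0"
  then show "normalized_E f" using assms unfolding normalized_E_def simple_E_with_def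
    by (auto intro!: exI[of _ 0])
qed

lemma simple_normalized_mult:
  assumes "simple_E f" "normalized_E f" "simple_E g" "normalized_E g" "E_support f = E_support g"
  shows "simple_E (f * g) \<and> normalized_E (f * g) \<and> E_support (f * g) = E_support f"
proof -
  obtain \<beta> \<gamma> where bg: "simple_E_with \<beta> f" "simple_E_with \<gamma> g" using assms unfolding simple_E_def by blast
  then have "rat_line \<gamma> = rat_line \<beta>" using assms(5) E_support_eq by metis
  then have g: "simple_E_with \<beta> g" using simple_E_with_change_generator[OF bg(2)] by blast
  have fg: "simple_E_with \<beta> (f * g)" by (rule simple_E_with_mult[OF bg(1) g])
  have "fps_nth (f * g) 1 = fps_nth f 0 * fps_nth g 1 + fps_nth f 1 * fps_nth g 0"
    by (simp add: fps_mult_nth)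
  then have "normalized_E (f * g)"
    using assms(2,4) unfolding normalized_simple_iff[OF fg] normalized_simple_iff[OF bg(1)]
      normalized_simple_iff[OF g] by simp
  then show ?thesis using fg E_support_eq[OF fg] E_support_eq[OF bg(1)] unfolding simple_E_def by auto
qed

text \<open>Concatenating ss and ts could repeat a support. Factors with equal support are
  multiplied instead, whereas irreducible factors may be repeated and are simply
  concatenated.\<close>

lemma E_factorization_mult:
  assumes "E_factorization f u ss hs" "E_factorization g v ts ks"
  obtains us where "E_factorization (f * g) (u * v) us (hs @ ks)"
    "\<forall>V. support_part V us = support_part V ss * support_part V ts"
proof -
  have ss: "\<forall>s\<in>set ss. simple_E s \<and> normalized_E s" "distinct (map E_support ss)"
    and ts: "\<forall>s\<in>set ts. simple_E s \<and> normalized_E s" "distinct (map E_support ts)"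
    using assms unfolding E_factorization_def by auto
  define S where "S = (\<lambda>V. support_part V ss * support_part V ts)"
  \<comment> \<open>Each line that occurs on either side is listed once; this yields distinct
    supports for us.\<close>
  define Vs where "Vs = remdups (map E_support (ss @ ts))"
  define us where "us = map S Vs"
  have S: "simple_E (S V) \<and> normalized_E (S V) \<and> E_support (S V) = V" if V: "V \<in> set Vs" for V
  proof (cases "V \<in> E_support ` set ss")
    case True
    then obtain s where s: "s \<in> set ss" "V = E_support s" by auto
    have s1: "support_part V ss = s" using support_part_eq[OF ss(2) s(1)] s(2) by simp
    show ?thesis
    proof (cases "V \<in> E_support ` set ts")
      case True
      then obtain t where t: "t \<in> set ts" "V = E_support t" by auto
      have t1: "support_part V ts = t" using support_part_eq[OF ts(2) t(1)] t(2) by simp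
      have "S V = s * t" by (simp only: S_def s1 t1)
      then show ?thesis using simple_normalized_mult[of s t] s t ss(1) ts(1) by simp
    next
      case False
      then have "S V = s" unfolding S_def s1 support_part_eq_1[OF False] by simp
      then show ?thesis using s ss(1) by simp
    qed
  next
    case False
    then obtain t where t: "t \<in> set ts" "V = E_support t" using V by (auto simp: Vs_def)
    have t1: "support_part V ts = t" using support_part_eq[OF ts(2) t(1)] t(2) by simp
    have "S V = t" unfolding S_def t1 support_part_eq_1[OF False] by simp
    then show ?thesis using t ts(1) by simp
  qed
  have supp: "map E_support us = Vs" unfolding us_def using S by (simp add: map_idI)
  then have distinct: "distinct (map E_support us)" by (simp add: Vs_def)
  have part: "support_part V us = S V" for V
  proof (cases "V \<in> set Vs")
    case True
    then have "S V \<in> set us" by (simp add: us_def)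
    from support_part_eq[OF distinct this] show ?thesis using S[OF True] by simp
  next
    case False
    then have "V \<notin> E_support ` set us" using supp by (metis set_map)
    moreover have "V \<notin> E_support ` set ss" "V \<notin> E_support ` set ts" using False by (auto simp: Vs_def)
    ultimately show ?thesis by (simp add: S_def support_part_eq_1)
  qed
  have "prod_list us = (\<Prod>V\<in>set Vs. support_part V us)"
    by (rule prod_list_support_part) (use arg_cong[OF supp, of set] in auto)
  also have "\<dots> = (\<Prod>V\<in>set Vs. support_part V ss) * (\<Prod>V\<in>set Vs. support_part V ts)"
    by (simp add: part S_def prod.distrib)
  also have "(\<Prod>V\<in>set Vs. support_part V ss) = prod_list ss"
    by (rule prod_list_support_part[symmetric]) (auto simp: Vs_def)
  also have "(\<Prod>V\<in>set Vs. support_part V ts) = prod_list ts"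
    by (rule prod_list_support_part[symmetric]) (auto simp: Vs_def)
  finally have "prod_list us = prod_list ss * prod_list ts" .
  moreover have "u * v \<in> Units E_ring"
    using E.Units_m_closed[of u v] assms unfolding E_factorization_def by simp
  ultimately have "E_factorization (f * g) (u * v) us (hs @ ks)"
    using assms distinct S unfolding E_factorization_def by (auto simp: us_def mult_ac)
  then show ?thesis using that part unfolding S_def by blast
qed

section \<open>Divisibility and gcds componentwise\<close>

lemma Conjecture_F_unique:
  assumes "Conjecture_F" "E_function f" "f \<noteq> 0" "E_factorization f u ss hs" "E_factorization f v ts ks"
  shows "mset ts = mset ss" "mset ks = mset hs"
proof -
  obtain w us ls where F: "\<And>w' us' ls'. E_factorization f w' us' ls' \<Longrightarrow>
      w' = w \<and> mset us' = mset us \<and> mset ls' = mset ls"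
    using assms(1-3) unfolding Conjecture_F_def by (simp, blast)
  show "mset ts = mset ss" "mset ks = mset hs" using F[OF assms(4)] F[OF assms(5)] by simp_all
qed

text \<open>The cofactor e also has a factorization. Its product with that of c is a factorization
  of f, so by uniqueness it has the components of the given one.\<close>

lemma Conjecture_F_factor_parts:
  assumes "Conjecture_F" "E_function f" "f \<noteq> 0" "E_factorization f u ss hs"
    and "E_function c" "E_function e" "f = c * e" "E_factorization c v ts ks"
  shows "support_part V ts divides\<^bsub>E_ring\<^esub> support_part V ss" "mset ks \<subseteq># mset hs"
proof -
  have "e \<noteq> 0" using assms(3,7) by auto
  then obtain w us ls where e: "E_factorization e w us ls"
    using assms(1,6) unfolding Conjecture_F_def by (simp, blast)
  obtain xs where xs: "E_factorization (c * e) (v * w) xs (ks @ ls)"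
    "\<forall>V. support_part V xs = support_part V ts * support_part V us"
    by (rule E_factorization_mult[OF assms(8) e])
  have eq: "mset xs = mset ss" "mset (ks @ ls) = mset hs"
    using Conjecture_F_unique[OF assms(1-4)] xs(1) assms(7) by blast+
  have "support_part V ss = support_part V ts * support_part V us"
    using support_part_mset_cong[OF eq(1)] xs(2) by simp
  moreover have "E_function (support_part V us)"
    by (rule E_function_support_part) (use e in \<open>auto simp: E_factorization_def normalized_E_def\<close>)
  ultimately show "support_part V ts divides\<^bsub>E_ring\<^esub> support_part V ss" unfolding E_divides_iff by blast
  show "mset ks \<subseteq># mset hs" using eq(2) by (metis mset_append mset_subset_eq_add_left)
qed

text \<open>If V occurs on both sides, the components are simple functions on one line; otherwise
  one of them is 1, and so is the gcd.\<close>

lemma support_part_gcd: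
  assumes "E_factorization f u ss hs" "E_factorization g v ts ks"
  shows "\<exists>d\<in>carrier E_ring. d gcdof\<^bsub>E_ring\<^esub> (support_part V ss) (support_part V ts)"
proof -
  have ss: "\<forall>s\<in>set ss. simple_E s \<and> normalized_E s" "distinct (map E_support ss)"
    and ts: "\<forall>s\<in>set ts. simple_E s \<and> normalized_E s" "distinct (map E_support ts)"
    using assms unfolding E_factorization_def by auto
  have E: "E_function (support_part V xs)" if "\<forall>s\<in>set xs. simple_E s \<and> normalized_E s" for xs
    by (rule E_function_support_part) (use that in \<open>auto simp: normalized_E_def\<close>)
  have one: "\<exists>d\<in>carrier E_ring. d gcdof\<^bsub>E_ring\<^esub> a b" if "a = 1 \<or> b = 1" "E_function a" "E_function b" for a b
  proof -
    have "1 gcdof\<^bsub>E_ring\<^esub> a b" using that by (auto simp: isgcd_def E_divides_iff)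
    then show ?thesis using E_function_1 by auto
  qed
  show ?thesis
  proof (cases "V \<in> E_support ` set ss \<and> V \<in> E_support ` set ts")
    case False
    then have "support_part V ss = 1 \<or> support_part V ts = 1" using support_part_eq_1 by blast
    then show ?thesis by (rule one) (use E ss(1) ts(1) in auto)
  next
    case True
    then obtain s t where st: "s \<in> set ss" "V = E_support s" "t \<in> set ts" "V = E_support t" by auto
    then have "support_part V ss = s" "support_part V ts = t"
      using support_part_eq[OF ss(2) st(1)] support_part_eq[OF ts(2) st(3)] by auto
    moreover obtain \<beta> \<gamma> where bg: "simple_E_with \<beta> s" "simple_E_with \<gamma> t"
      using ss(1) ts(1) st unfolding simple_E_def by blast
    moreover have "rat_line \<gamma> = rat_line \<beta>" using E_support_eq[OF bg(1)] E_support_eq[OF bg(2)] st by simp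
    ultimately show ?thesis using simple_E_with_gcd[of \<beta> s t] simple_E_with_change_generator[of \<gamma> t \<beta>] by simp
  qed
qed

lemma Conjecture_F_gcd:
  assumes F: "Conjecture_F" and a: "E_function a" "a \<noteq> 0" and b: "E_function b" "b \<noteq> 0"
  shows "\<exists>d\<in>carrier E_ring. d gcdof\<^bsub>E_ring\<^esub> a b"
proof -
  obtain u sa ha where fa: "E_factorization a u sa ha" using F a unfolding Conjecture_F_def by (simp, blast)
  obtain v sb hb where fb: "E_factorization b v sb hb" using F b unfolding Conjecture_F_def by (simp, blast)
  define T where "T = E_support ` set sa \<union> E_support ` set sb"
  have fin: "finite T" by (simp add: T_def)
  \<comment> \<open>The value 1 outside T makes products of G over T and over any larger finite set
    agree.\<close>
  define G where "G = (\<lambda>V. if V \<in> T then SOME d. d \<in> carrier E_ring \<and>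
     d gcdof\<^bsub>E_ring\<^esub> (support_part V sa) (support_part V sb) else 1)"
  have G: "E_function (G V)" "G V gcdof\<^bsub>E_ring\<^esub> (support_part V sa) (support_part V sb)" if "V \<in> T" for V
  proof -
    have "G V \<in> carrier E_ring \<and> G V gcdof\<^bsub>E_ring\<^esub> (support_part V sa) (support_part V sb)"
      using someI_ex[of "\<lambda>d. d \<in> carrier E_ring \<and> d gcdof\<^bsub>E_ring\<^esub> (support_part V sa) (support_part V sb)"]
        support_part_gcd[OF fa fb, of V] that by (auto simp: G_def)
    then show "E_function (G V)" "G V gcdof\<^bsub>E_ring\<^esub> (support_part V sa) (support_part V sb)" by auto
  qed
  define M where "M = mset ha \<inter># mset hb"
  define d where "d = (\<Prod>V\<in>T. G V) * prod_mset M"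
  have Eh: "\<And>h. h \<in># mset ha \<Longrightarrow> E_function h" "\<And>h. h \<in># mset hb \<Longrightarrow> E_function h"
    using fa fb unfolding E_factorization_def normalized_E_def by auto
  have EM: "E_function h" if "h \<in># M" for h using that Eh(1) unfolding M_def by auto
  have Ed: "E_function d"
    unfolding d_def by (intro E_function_mult E_function_prod E_function_prod_mset G EM)
  have a_eq: "a = (\<Prod>V\<in>T. support_part V sa) * prod_mset (mset ha) * u"
    using fa prod_list_support_part[OF fin, of sa] unfolding E_factorization_def prod_mset_prod_list
    by (simp add: T_def mult_ac)
  have b_eq: "b = (\<Prod>V\<in>T. support_part V sb) * prod_mset (mset hb) * v"
    using fb prod_list_support_part[OF fin, of sb] unfolding E_factorization_def prod_mset_prod_list
    by (simp add: T_def mult_ac)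
  have one_div: "1 divides\<^bsub>E_ring\<^esub> w" if "E_function w" for w using that by (auto simp: E_divides_iff)
  have Euv: "E_function u" "E_function v"
    using fa fb unfolding E_factorization_def Units_def by auto
  \<comment> \<open>The factor 1 is matched with the unit u of a, since d carries no unit.\<close>
  have "d * 1 divides\<^bsub>E_ring\<^esub> a"
    unfolding d_def a_eq M_def
    by (intro E_divides_mult E_divides_prod E_divides_prod_mset one_div Euv Eh)
       (use G(2) in \<open>auto simp: isgcd_def\<close>)
  moreover have "d * 1 divides\<^bsub>E_ring\<^esub> b"
    unfolding d_def b_eq M_def
    by (intro E_divides_mult E_divides_prod E_divides_prod_mset one_div Euv Eh)
       (use G(2) in \<open>auto simp: isgcd_def\<close>)
  moreover have "c divides\<^bsub>E_ring\<^esub> d"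
    if c: "E_function c" "c divides\<^bsub>E_ring\<^esub> a" "c divides\<^bsub>E_ring\<^esub> b" for c
  proof -
    obtain e where e: "E_function e" "a = c * e" using c(2) unfolding E_divides_iff by blast
    obtain e' where e': "E_function e'" "b = c * e'" using c(3) unfolding E_divides_iff by blast
    have "c \<noteq> 0" using a(2) e(2) by auto
    then obtain w sc hc where fc: "E_factorization c w sc hc"
      using F c(1) unfolding Conjecture_F_def by (simp, blast)
    have pa: "support_part V sc divides\<^bsub>E_ring\<^esub> support_part V sa" "mset hc \<subseteq># mset ha" for V
      using Conjecture_F_factor_parts[OF F a fa c(1) e fc] by blast+
    have pb: "support_part V sc divides\<^bsub>E_ring\<^esub> support_part V sb" "mset hc \<subseteq># mset hb" for V
      using Conjecture_F_factor_parts[OF F b fb c(1) e' fc] by blast+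
    \<comment> \<open>A priori c could have supports outside T. There its component divides a
      component of a that equals 1, in accordance with the value of G.\<close>
    define T' where "T' = T \<union> E_support ` set sc"
    have fin': "finite T'" using fin by (simp add: T'_def)
    have part: "support_part V sc divides\<^bsub>E_ring\<^esub> G V" for V
    proof (cases "V \<in> T")
      case True
      have "E_function (support_part V sc)"
        by (rule E_function_support_part) (use fc in \<open>auto simp: E_factorization_def normalized_E_def\<close>)
      then show ?thesis using G(2)[OF True] pa(1)[of V] pb(1)[of V] by (auto simp: isgcd_def)
    next
      case False
      then have "support_part V sa = 1" by (intro support_part_eq_1) (auto simp: T_def)
      then show ?thesis using pa(1)[of V] False by (simp add: G_def)
    qed
    have "(\<Prod>V\<in>T'. G V) = (\<Prod>V\<in>T. G V)"
      by (rule prod.mono_neutral_right[OF fin']) (auto simp: T'_def G_def)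
    moreover have "(\<Prod>V\<in>T'. support_part V sc) divides\<^bsub>E_ring\<^esub> (\<Prod>V\<in>T'. G V)"
      by (rule E_divides_prod) (rule part)
    moreover have "prod_mset (mset hc) divides\<^bsub>E_ring\<^esub> prod_mset M"
      by (rule E_divides_prod_mset[OF _ EM]) (use pa(2) pb(2) in \<open>auto simp: M_def\<close>)
    \<comment> \<open>Being a unit, the leading factor of c is absorbed by a trailing 1.\<close>
    moreover have "w divides\<^bsub>E_ring\<^esub> 1"
      using fc unfolding E_factorization_def Units_def E_divides_iff by (auto intro: sym)
    ultimately have "(\<Prod>V\<in>T'. support_part V sc) * prod_mset (mset hc) * w divides\<^bsub>E_ring\<^esub>
        (\<Prod>V\<in>T. G V) * prod_mset M * 1" by (metis E_divides_mult)
    moreover have "c = (\<Prod>V\<in>T'. support_part V sc) * prod_mset (mset hc) * w"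
      using fc prod_list_support_part[OF fin', of sc] unfolding E_factorization_def prod_mset_prod_list
      by (simp add: T'_def mult_ac)
    ultimately show ?thesis by (simp add: d_def)
  qed
  ultimately have "d gcdof\<^bsub>E_ring\<^esub> a b" by (auto simp: isgcd_def)
  then show ?thesis using Ed by auto
qed

theorem theorem7:
  shows "domain E_ring \<and> \<not> factorial_domain E_ring \<and> \<not> noetherian_ring E_ring \<and>
         (Conjecture_F \<longrightarrow> gcd_domain E_ring)"
  using E.domain_axioms E_ring_not_factorial E_ring_not_noetherian Conjecture_F_gcd
  unfolding gcd_domain_def by auto

end
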